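(* Let $\Theta=(\Gamma,(x_{k,i}))$ be a patch framework with $\Gamma$ connected and with every view affinely non-degenerate. Let $S^*\in\mathbb{O}(d)^m$ be a non-degenerate alignment and $\widetilde S^*=\pi(S^* )$. If the sequence $\{\widetilde S^k\}_{k\ge0}$ generated by the Riemannian gradient descent algorithm (with any initial point $\widetilde S^0\in\mathbb{O}(d)^{m-1}$ and parameters $\beta,\gamma\in(0,1)$) converges to $\widetilde S^*$, then the convergence is linear.
   Context: Patch framework. $\Gamma$ is a bipartite graph on $n+m$ vertices; vertex $k\in\{1,\dots,n\}$ represents the $k$th point and vertex $n+i$, $i\in\{1,\dots,m\}$, the $i$th view; $(k,i)\in E(\Gamma)$ means that point $k$ is in view $i$, with local coordinates $x_{k,i}\in\mathbb{R}^d$. The tuple $\Theta=(\Gamma,(x_{k,i}))$ is a patch framework. A view $i$ is affinely non-degenerate if it has at least $d+1$ points and the affine span of $\{x_{k,i}:(k,i)\in E(\Gamma)\}$ has dimension $d$. Put $e_{ki}=e_k-e_{n+i}\in\mathbb{R}^{n+m}$, $\varepsilon_i$ the $i$th standard basis vector of $\mathbb{R}^m$, $\mathcal{L}_\Gamma=\sum_{(k,i)\in E(\Gamma)}e_{ki}e_{ki}^T$, $B=\sum_{(k,i)\in E(\Gamma)}(\varepsilon_i\otimes I_d)x_{k,i}e_{ki}^T$, $D=\sum_{(k,i)\in E(\Gamma)}(\varepsilon_i\otimes I_d)x_{k,i}x_{k,i}^T(\varepsilon_i\otimes I_d)^T$, and $C=D-B\mathcal{L}_\Gamma^\dagger B^T\in\mathbb{R}^{md\times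 md}$ (positive semi-definite), where $\dagger$ is the Moore–Penrose pseudoinverse. An alignment is an element $S=[S_i]_1^m$ (vertical stack) of $\mathbb{O}(d)^m\subseteq\mathbb{R}^{md\times d}$; $F(S)=\mathrm{Tr}(CSS^T)$. $[A]_i$ denotes the $i$th $d$-row block of $A$. Let $\pi:\mathbb{O}(d)^m\to\mathbb{O}(d)^{m-1}$, $\pi(S)=[S_{i+1}S_1^T]_{i=1}^{m-1}$ (identifying $\mathbb{O}(d)^m/_\sim$, $S\sim SQ$ for $Q\in\mathbb{O}(d)$, with $\mathbb{O}(d)^{m-1}$), and $\widetilde F:\mathbb{O}(d)^{m-1}\to\mathbb{R}$, $\widetilde F(\widetilde S)=\mathrm{Tr}\left(C\begin{bmatrix}I_d\\ \widetilde S\end{bmatrix}\begin{bmatrix}I_d\\ \widetilde S\end{bmatrix}^T\right)$. $S$ is non-degenerate if $\pi(S)$ is a local minimizer of $\widetilde F$ at which the Hessian is non-singular (at a critical point this does not depend on the Riemannian metric). Algorithm (Riemannian gradient descent). Let $\nabla F(S)=2CS$ and $\mathrm{grad}\,F(S)=\left[[CS]_i-S_i[CS]_i^TS_i\right]_1^m$ (its orthogonal projection onto the tangent space of $\mathbb{O}(d)^m$ at $S$), and $R(S,\xi)=[S_i\exp(S_i^T\xi_i)]_1^m$ with $\exp$ the matrix exponential. Given $\widetilde S^k$: set $S^k=\begin{bmatrix}I_d\\ \widetilde S^k\end{bmatrix}$; set $$\alpha_k=\max_{l\in\{0,1,2,\dots\}}\{\beta^l: F(R(S^k,-\beta^l\mathrm{grad}F(S^k)))-F(S^k)\le-\gamma\beta^l\,\mathrm{Tr}(\nabla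 F(S^k)^T\mathrm{grad}F(S^k))\};$$ set $\widetilde S^{k+1}=\pi(R(S^k,-\alpha_k\mathrm{grad}F(S^k)))$. Linear convergence means that there are constants $c>0$ and $q\in(0,1)$ with $\|\widetilde S^k-\widetilde S^*\|_F\le c\,q^k$ for all $k$. *)

theory Defs
  imports "HOL-Analysis.Analysis"
begin

text \<open>
  Points, views and coordinate directions are indexed by finite types \<open>'n\<close>, \<open>'m\<close>, \<open>'d\<close>, so that
  \<open>n = CARD('n)\<close>, \<open>m = CARD('m)\<close>, \<open>d = CARD('d)\<close>. A matrix in \<open>\<real>\<^sup>m\<^sup>d\<^sup>\<times>\<^sup>d\<close> has row index type
  \<open>'m \<times> 'd\<close>; row \<open>(i, a)\<close> is the \<open>a\<close>-th row of the \<open>i\<close>-th block. The order on \<open>'m\<close> serves only to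
  say which view is the first. The library norm and inner product of \<open>real ^ 'a ^ 'b\<close> are those of
  Frobenius.
\<close>

type_synonym ('m, 'd) stack = "real ^ 'd ^ ('m \<times> 'd)"

definition block :: "('m::finite, 'd::finite) stack \<Rightarrow> 'm \<Rightarrow> real ^ 'd ^ 'd" where
  "block A i = (\<chi> a. A $ (i, a))"

definition stack :: "('m::finite \<Rightarrow> real ^ 'd ^ 'd) \<Rightarrow> ('m, 'd::finite) stack" where
  "stack f = (\<chi> p. f (fst p) $ snd p)"

lemma block_stack [simp]: "block (stack f) i = f i"
  by (simp add: block_def stack_def vec_eq_iff)

lemma stack_block [simp]: "stack (block A) = A"
  by (simp add: block_def stack_def vec_eq_iff)

definition first_view :: "'m::{finite, linorder}" where
  "first_view = Min UNIV"

text \<open>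
  A patch framework is given by the edge set \<open>E\<close> of the bipartite graph, where \<open>(k, i) \<in> E\<close> iff point
  \<open>k\<close> is in view \<open>i\<close>, and by the local coordinates \<open>x k i\<close>, which matter only for \<open>(k, i) \<in> E\<close>.
  The vertex set of the graph is the sum type \<open>'n + 'm\<close>.
\<close>

definition graph_connected :: "('n \<times> 'm) set \<Rightarrow> bool" where
  "graph_connected E \<longleftrightarrow>
     (let A = (\<lambda>(k, i). (Inl k, Inr i)) ` E in \<forall>u v. (u, v) \<in> (A \<union> A\<inverse>)\<^sup>*)"

definition affinely_nondegenerate ::
    "('n::finite \<times> 'm) set \<Rightarrow> ('n \<Rightarrow> 'm \<Rightarrow> real ^ 'd::finite) \<Rightarrow> 'm \<Rightarrow> bool" where
  "affinely_nondegenerate E x i \<longleftrightarrow>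
     card {k. (k, i) \<in> E} \<ge> CARD('d) + 1 \<and>
     aff_dim (affine hull {x k i | k. (k, i) \<in> E}) = int CARD('d)"

definition outer :: "real ^ 'a \<Rightarrow> real ^ 'b \<Rightarrow> real ^ 'b ^ 'a" where
  "outer u v = (\<chi> a b. u $ a * v $ b)"

definition kron_id :: "real ^ 'm \<Rightarrow> ('m::finite, 'd::finite) stack" where
  "kron_id v = stack (\<lambda>i. v $ i *\<^sub>R mat 1)"

definition moore_penrose :: "real ^ 'b::finite ^ 'a::finite \<Rightarrow> real ^ 'a ^ 'b" where
  "moore_penrose A = (THE X. A ** X ** A = A \<and> X ** A ** X = X \<and>
     transpose (A ** X) = A ** X \<and> transpose (X ** A) = X ** A)"

definition edge_vec :: "'n::finite \<Rightarrow> 'm::finite \<Rightarrow> real ^ ('n + 'm)" where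
  "edge_vec k i = axis (Inl k) 1 - axis (Inr i) 1"

definition laplacian :: "('n::finite \<times> 'm::finite) set \<Rightarrow> real ^ ('n + 'm) ^ ('n + 'm)" where
  "laplacian E = (\<Sum>(k, i)\<in>E. outer (edge_vec k i) (edge_vec k i))"

definition B_mat ::
    "('n::finite \<times> 'm::finite) set \<Rightarrow> ('n \<Rightarrow> 'm \<Rightarrow> real ^ 'd::finite) \<Rightarrow> real ^ ('n + 'm) ^ ('m \<times> 'd)" where
  "B_mat E x = (\<Sum>(k, i)\<in>E. kron_id (axis i 1) ** outer (x k i) (edge_vec k i))"

definition D_mat ::
    "('n::finite \<times> 'm::finite) set \<Rightarrow> ('n \<Rightarrow> 'm \<Rightarrow> real ^ 'd::finite) \<Rightarrow> real ^ ('m \<times> 'd) ^ ('m \<times> 'd)" where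
  "D_mat E x = (\<Sum>(k, i)\<in>E.
     kron_id (axis i 1) ** outer (x k i) (x k i) ** transpose (kron_id (axis i 1)))"

definition C_mat ::
    "('n::finite \<times> 'm::finite) set \<Rightarrow> ('n \<Rightarrow> 'm \<Rightarrow> real ^ 'd::finite) \<Rightarrow> real ^ ('m \<times> 'd) ^ ('m \<times> 'd)" where
  "C_mat E x = D_mat E x - B_mat E x ** moore_penrose (laplacian E) ** transpose (B_mat E x)"

definition alignments :: "('m::finite, 'd::finite) stack set" where
  "alignments = {S. \<forall>i. orthogonal_matrix (block S i)}"

text \<open>
  The space of \<open>(m - 1)d \<times> d\<close> matrices is encoded as the linear subspace of those stacks whose first
  block vanishes. (An index type for the \<open>m - 1\<close> remaining views would exclude \<open>m = 1\<close>.)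
\<close>

definition reduced_alignments :: "('m::{finite, linorder}, 'd::finite) stack set" where
  "reduced_alignments =
     {X. block X first_view = 0 \<and> (\<forall>i. i \<noteq> first_view \<longrightarrow> orthogonal_matrix (block X i))}"

definition reduce :: "('m::{finite, linorder}, 'd::finite) stack \<Rightarrow> ('m, 'd) stack" where
  "reduce S = stack (\<lambda>i. if i = first_view then 0 else block S i ** transpose (block S first_view))"

definition prepend_id :: "('m::{finite, linorder}, 'd::finite) stack \<Rightarrow> ('m, 'd) stack" where
  "prepend_id X = stack (\<lambda>i. if i = first_view then mat 1 else block X i)"

definition objective ::
    "real ^ ('m \<times> 'd) ^ ('m \<times> 'd) \<Rightarrow> ('m::finite, 'd::finite) stack \<Rightarrow> real" where
  "objective C S = trace (C ** (S ** transpose S))"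

definition reduced_objective ::
    "real ^ ('m \<times> 'd) ^ ('m \<times> 'd) \<Rightarrow> ('m::{finite, linorder}, 'd::finite) stack \<Rightarrow> real" where
  "reduced_objective C X = trace (C ** (prepend_id X ** transpose (prepend_id X)))"

definition local_minimizer_on ::
    "'a::metric_space set \<Rightarrow> ('a \<Rightarrow> real) \<Rightarrow> 'a \<Rightarrow> bool" where
  "local_minimizer_on M f p \<longleftrightarrow>
     p \<in> M \<and> (\<exists>e>0. \<forall>y\<in>M. dist y p < e \<longrightarrow> f p \<le> f y)"

definition reduced_tangent ::
    "('m::{finite, linorder}, 'd::finite) stack \<Rightarrow> ('m, 'd) stack set" where
  "reduced_tangent X = {Z. block Z first_view = 0 \<and> (\<forall>i. i \<noteq> first_view \<longrightarrow>
     transpose (block X i) ** block Z i + transpose (block Z i) ** block X i = 0)}"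

text \<open>
  For \<open>X\<close> in \<^const>\<open>reduced_alignments\<close> this is the orthogonal projection onto the tangent space
  (see the two lemmas below); the formula extends it smoothly to all \<open>X\<close>.
\<close>

definition reduced_proj ::
    "('m::{finite, linorder}, 'd::finite) stack \<Rightarrow> ('m, 'd) stack \<Rightarrow> ('m, 'd) stack" where
  "reduced_proj X Z = stack (\<lambda>i. if i = first_view then 0
     else (1 / 2) *\<^sub>R (block Z i - block X i ** transpose (block Z i) ** block X i))"

lemma reduced_proj_in_tangent:
  fixes X Z :: "('m::{finite, linorder}, 'd::finite) stack"
  assumes "X \<in> reduced_alignments"
  shows "reduced_proj X Z \<in> reduced_tangent X"
proof -
  have "transpose Q ** (M - Q ** transpose M ** Q) + transpose (M - Q ** transpose M ** Q) ** Q = 0"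
    if "orthogonal_matrix Q" for Q M :: "real ^ 'd ^ 'd"
  proof -
    have 1: "transpose Q ** Q = mat 1" using that by (simp add: orthogonal_matrix_def)
    have "transpose Q ** (Q ** transpose M ** Q) = transpose M ** Q"
      by (simp add: matrix_mul_assoc 1)
    moreover have "transpose (Q ** transpose M ** Q) ** Q = transpose Q ** M"
      by (simp add: matrix_transpose_mul 1 flip: matrix_mul_assoc)
    moreover have "transpose (M - Q ** transpose M ** Q) = transpose M - transpose (Q ** transpose M ** Q)"
      by (simp add: transpose_def vec_eq_iff)
    moreover have "P ** (R - T) = P ** R - P ** T" "(R - T) ** P = R ** P - T ** P"
      for P R T :: "real ^ 'd ^ 'd"
      by (simp_all add: matrix_matrix_mult_def vec_eq_iff algebra_simps sum_subtractf)
    ultimately show ?thesis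
      by simp
  qed
  moreover have "transpose Q ** (c *\<^sub>R M) + transpose (c *\<^sub>R M) ** Q =
      c *\<^sub>R (transpose Q ** M + transpose M ** Q)" for Q M :: "real ^ 'd ^ 'd" and c
    by (simp add: matrix_matrix_mult_def transpose_def vec_eq_iff sum_distrib_left algebra_simps)
  ultimately show ?thesis
    using assms unfolding reduced_proj_def reduced_tangent_def reduced_alignments_def by simp
qed

lemma reduced_proj_orthogonal:
  fixes X Z W :: "('m::{finite, linorder}, 'd::finite) stack"
  assumes "X \<in> reduced_alignments" and "W \<in> reduced_tangent X"
  shows "(Z - reduced_proj X Z) \<bullet> W = 0"
proof -
  have inner_trace: "P \<bullet> Q = trace (transpose P ** Q)" for P Q :: "real ^ 'd ^ 'd"
    unfolding trace_def inner_vec_def matrix_matrix_mult_def transpose_def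
    by simp (rule sum.swap)
  have inner_block: "A \<bullet> A' = (\<Sum>i\<in>UNIV. block A i \<bullet> block A' i)" for A A' :: "('m, 'd) stack"
    unfolding inner_vec_def block_def
    by (simp add: sum.cartesian_product flip: UNIV_Times_UNIV)
      (simp add: sum.cartesian_product' flip: UNIV_Times_UNIV)
  have key: "(M + Q ** transpose M ** Q) \<bullet> V = 0"
    if "orthogonal_matrix Q" "transpose Q ** V + transpose V ** Q = 0" for Q M V :: "real ^ 'd ^ 'd"
  proof -
    have 1: "Q ** transpose Q = mat 1" using that by (simp add: orthogonal_matrix_def)
    have 2: "transpose Q ** V = - (transpose V ** Q)"
      using that(2) by (simp add: eq_neg_iff_add_eq_0)
    have neg: "P ** (- R) = - (P ** R)" for P R :: "real ^ 'd ^ 'd"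
      by (simp add: matrix_matrix_mult_def vec_eq_iff sum_negf)
    have "(Q ** transpose M ** Q) \<bullet> V = trace (transpose Q ** M ** (transpose Q ** V))"
      by (simp add: inner_trace matrix_transpose_mul matrix_mul_assoc)
    also have "\<dots> = - trace (transpose Q ** (M ** transpose V ** Q))"
      unfolding 2 matrix_mul_assoc[symmetric]
      by (simp add: neg trace_def sum_negf)
    also have "trace (transpose Q ** (M ** transpose V ** Q)) = trace (M ** transpose V ** (Q ** transpose Q))"
      by (subst trace_mul_sym) (simp add: matrix_mul_assoc)
    also have "\<dots> = M \<bullet> V"
      by (simp add: 1 inner_trace trace_mul_sym[of M "transpose V"])
        (metis inner_commute inner_trace)
    finally show ?thesis by (simp add: inner_add_left)
  qed
  have "block (Z - reduced_proj X Z) i \<bullet> block W i = 0" for i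
  proof (cases "i = first_view")
    case False
    let ?Q = "block X i" and ?M = "block Z i"
    have "block (Z - reduced_proj X Z) i = ?M - block (reduced_proj X Z) i"
      by (simp add: block_def vec_eq_iff)
    also have "\<dots> = (1 / 2) *\<^sub>R (?M + ?Q ** transpose ?M ** ?Q)"
      using False by (simp add: reduced_proj_def vec_eq_iff field_simps)
    finally show ?thesis
      using key[of ?Q "block W i" ?M] assms False
      by (simp add: reduced_alignments_def reduced_tangent_def)
  qed (use assms in \<open>simp add: reduced_tangent_def\<close>)
  then show ?thesis by (simp add: inner_block)
qed

text \<open>
  The Hessian with respect to the metric induced by the Frobenius inner product: the covariant
  derivative of a vector field on an embedded submanifold is the tangential part of the derivative
  of any smooth extension of the field to the ambient space.
\<close>

definition euclidean_grad :: "('a::real_inner \<Rightarrow> real) \<Rightarrow> 'a \<Rightarrow> 'a" where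
  "euclidean_grad f p = (THE g. GDERIV f p :> g)"

definition reduced_grad ::
    "(('m::{finite, linorder}, 'd::finite) stack \<Rightarrow> real) \<Rightarrow> ('m, 'd) stack \<Rightarrow> ('m, 'd) stack" where
  "reduced_grad f X = reduced_proj X (euclidean_grad f X)"

definition reduced_hess ::
    "(('m::{finite, linorder}, 'd::finite) stack \<Rightarrow> real) \<Rightarrow> ('m, 'd) stack \<Rightarrow>
     ('m, 'd) stack \<Rightarrow> ('m, 'd) stack" where
  "reduced_hess f X Z = reduced_proj X (frechet_derivative (reduced_grad f) (at X) Z)"

definition hess_nonsingular ::
    "(('m::{finite, linorder}, 'd::finite) stack \<Rightarrow> real) \<Rightarrow> ('m, 'd) stack \<Rightarrow> bool" where
  "hess_nonsingular f X \<longleftrightarrow> (\<forall>Z\<in>reduced_tangent X. reduced_hess f X Z = 0 \<longrightarrow> Z = 0)"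

definition nondegenerate ::
    "real ^ ('m \<times> 'd) ^ ('m \<times> 'd) \<Rightarrow> ('m::{finite, linorder}, 'd::finite) stack \<Rightarrow> bool" where
  "nondegenerate C S \<longleftrightarrow>
     local_minimizer_on reduced_alignments (reduced_objective C) (reduce S) \<and>
     hess_nonsingular (reduced_objective C) (reduce S)"

definition matrix_exp :: "real ^ 'd ^ 'd \<Rightarrow> real ^ 'd::finite ^ 'd" where
  "matrix_exp A = (\<Sum>k. (1 / fact k) *\<^sub>R (((**) A) ^^ k) (mat 1))"

definition nabla_objective ::
    "real ^ ('m \<times> 'd) ^ ('m \<times> 'd) \<Rightarrow> ('m::finite, 'd::finite) stack \<Rightarrow> ('m, 'd) stack" where
  "nabla_objective C S = 2 *\<^sub>R (C ** S)"

definition grad_objective ::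
    "real ^ ('m \<times> 'd) ^ ('m \<times> 'd) \<Rightarrow> ('m::finite, 'd::finite) stack \<Rightarrow> ('m, 'd) stack" where
  "grad_objective C S = stack (\<lambda>i.
     block (C ** S) i - block S i ** transpose (block (C ** S) i) ** block S i)"

definition retract :: "('m::finite, 'd::finite) stack \<Rightarrow> ('m, 'd) stack \<Rightarrow> ('m, 'd) stack" where
  "retract S Z = stack (\<lambda>i. block S i ** matrix_exp (transpose (block S i) ** block Z i))"

definition armijo_steps ::
    "real ^ ('m \<times> 'd) ^ ('m \<times> 'd) \<Rightarrow> real \<Rightarrow> real \<Rightarrow> ('m::finite, 'd::finite) stack \<Rightarrow> real set" where
  "armijo_steps C \<beta> \<gamma> S = {\<beta> ^ l | l :: nat.
     objective C (retract S (- (\<beta> ^ l) *\<^sub>R grad_objective C S)) - objective C S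
       \<le> - \<gamma> * \<beta> ^ l * trace (transpose (nabla_objective C S) ** grad_objective C S)}"

text \<open>
  \<^const>\<open>Greatest\<close> rather than \<^const>\<open>Max\<close> because the set of admissible step sizes is infinite.
\<close>

definition step_size ::
    "real ^ ('m \<times> 'd) ^ ('m \<times> 'd) \<Rightarrow> real \<Rightarrow> real \<Rightarrow> ('m::finite, 'd::finite) stack \<Rightarrow> real" where
  "step_size C \<beta> \<gamma> S = (GREATEST a. a \<in> armijo_steps C \<beta> \<gamma> S)"

definition rgd_step ::
    "real ^ ('m \<times> 'd) ^ ('m \<times> 'd) \<Rightarrow> real \<Rightarrow> real \<Rightarrow>
     ('m::{finite, linorder}, 'd::finite) stack \<Rightarrow> ('m, 'd) stack" where
  "rgd_step C \<beta> \<gamma> X = (let S = prepend_id X in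
     reduce (retract S (- step_size C \<beta> \<gamma> S *\<^sub>R grad_objective C S)))"

definition rgd_sequence ::
    "real ^ ('m \<times> 'd) ^ ('m \<times> 'd) \<Rightarrow> real \<Rightarrow> real \<Rightarrow>
     (nat \<Rightarrow> ('m::{finite, linorder}, 'd::finite) stack) \<Rightarrow> bool" where
  "rgd_sequence C \<beta> \<gamma> X \<longleftrightarrow>
     X 0 \<in> reduced_alignments \<and> (\<forall>k. X (Suc k) = rgd_step C \<beta> \<gamma> (X k))"

definition linear_convergence :: "(nat \<Rightarrow> 'a::real_normed_vector) \<Rightarrow> 'a \<Rightarrow> bool" where
  "linear_convergence X p \<longleftrightarrow> (\<exists>c>0. \<exists>q. 0 < q \<and> q < 1 \<and> (\<forall>k. norm (X k - p) \<le> c * q ^ k))"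

end

theory Submission
  imports Defs
begin

text \<open>
  Along the retraction the objective satisfies \<open>F (R (S, - t G)) - F S \<le> - t |G|\<^sup>2 + K t\<^sup>2 |G|\<^sup>2\<close> with \<open>K\<close>
  uniform over the alignments, so the step sizes are bounded below; hence the gradients tend to \<open>0\<close> and
  the limit \<open>P\<close> is critical. At a critical point with non-singular Hessian the gradient is bounded below
  by a multiple of the distance, and the excess of the objective above by a multiple of its square. This
  yields the gradient domination \<open>f X - f P \<le> c |grad f X|\<^sup>2\<close>, which together with the sufficient decrease
  makes the objective values, and then the steps, decay geometrically.
\<close>

subsection \<open>The Frobenius norm and matrix multiplication\<close>

text \<open>The algorithm and the non-degeneracy hypothesis speak of different gradients: the steps
  follow the gradient of \<open>F\<close> over all \<open>m\<close> blocks, taken at the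
  representative whose first block is the identity, while the Hessian belongs to the objective with
  that block frozen. The two are not identified through a quotient metric: the reduced gradient is
  the full one with its first block deleted, hence not longer, and gradient domination needs only
  this direction. Normalising the first block after a step costs a constant factor in length.

  The Hessian acts on tangent vectors at \<open>P\<close>, but the chord \<open>X - P\<close> is not
  tangent. Charts and geodesics are avoided: the gradient field is differentiated as a polynomial
  map of the ambient space, and the normal part of the chord is quadratic in its length. The same
  fact bounds the excess of the objective, since the ambient gradient at a critical point is normal.

  The uniformity of \<open>K\<close> rests on \<open>exp (t A)\<close> staying orthogonal for skew
  \<open>A\<close>.\<close>

lemma matrix_inner_sum:
  fixes A B :: "real ^ 'b ^ 'a"
  shows "A \<bullet> B = (\<Sum>i\<in>UNIV. \<Sum>j\<in>UNIV. A $ i $ j * B $ i $ j)"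
  by (simp add: inner_vec_def)

lemma inner_transpose:
  fixes A B :: "real ^ 'b ^ 'a"
  shows "transpose A \<bullet> transpose B = A \<bullet> B"
  unfolding matrix_inner_sum transpose_def by simp (rule sum.swap)

lemma norm_transpose:
  fixes A :: "real ^ 'b ^ 'a"
  shows "norm (transpose A) = norm A"
  by (simp add: norm_eq_sqrt_inner inner_transpose)

lemma inner_matrix_mult_right:
  fixes A :: "real ^ 'b ^ 'a" and B :: "real ^ 'c ^ 'b"
  shows "(A ** B) \<bullet> D = A \<bullet> (D ** transpose B)"
proof -
  have "(A ** B) \<bullet> D = (\<Sum>i\<in>UNIV. \<Sum>j\<in>UNIV. \<Sum>k\<in>UNIV. A $ i $ k * B $ k $ j * D $ i $ j)"
    by (simp add: matrix_inner_sum matrix_matrix_mult_def sum_distrib_right)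
  also have "\<dots> = (\<Sum>i\<in>UNIV. \<Sum>k\<in>UNIV. \<Sum>j\<in>UNIV. A $ i $ k * B $ k $ j * D $ i $ j)"
    by (rule sum.cong[OF refl], rule sum.swap)
  also have "\<dots> = A \<bullet> (D ** transpose B)"
    by (simp add: matrix_inner_sum matrix_matrix_mult_def transpose_def sum_distrib_left algebra_simps)
  finally show ?thesis .
qed

lemma inner_matrix_mult_left:
  fixes A :: "real ^ 'b ^ 'a" and B :: "real ^ 'c ^ 'b"
  shows "(A ** B) \<bullet> D = B \<bullet> (transpose A ** D)"
proof -
  have "(A ** B) \<bullet> D = (transpose B ** transpose A) \<bullet> transpose D"
    by (metis inner_transpose matrix_transpose_mul)
  also have "\<dots> = transpose B \<bullet> transpose (transpose A ** D)"
    by (simp add: inner_matrix_mult_right matrix_transpose_mul)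
  finally show ?thesis by (simp add: inner_transpose)
qed

lemma trace_transpose_mult:
  fixes A B :: "real ^ 'b ^ 'a"
  shows "trace (transpose A ** B) = A \<bullet> B"
  unfolding trace_def matrix_inner_sum matrix_matrix_mult_def transpose_def
  by simp (rule sum.swap)

text \<open>Each entry of the product is a row of \<open>A\<close> against a column of
  \<open>B\<close>; after Cauchy-Schwarz on every entry the double sum of the bounds
  factors.\<close>

lemma norm_matrix_mult_le:
  fixes A :: "real ^ 'b ^ 'a" and B :: "real ^ 'c ^ 'b"
  shows "norm (A ** B) \<le> norm A * norm B"
proof -
  have entry: "(A ** B) $ i $ j = A $ i \<bullet> transpose B $ j" for i j
    by (simp add: matrix_matrix_mult_def transpose_def inner_vec_def)
  have "(norm (A ** B))\<^sup>2 = (\<Sum>i\<in>UNIV. \<Sum>j\<in>UNIV. (A $ i \<bullet> transpose B $ j)\<^sup>2)"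
    by (simp add: power2_norm_eq_inner matrix_inner_sum entry flip: power2_eq_square)
  also have "\<dots> \<le> (\<Sum>i\<in>UNIV. \<Sum>j\<in>UNIV. (norm (A $ i))\<^sup>2 * (norm (transpose B $ j))\<^sup>2)"
  proof (intro sum_mono)
    fix i j
    have "\<bar>A $ i \<bullet> transpose B $ j\<bar> \<le> norm (A $ i) * norm (transpose B $ j)"
      by (rule Cauchy_Schwarz_ineq2)
    then show "(A $ i \<bullet> transpose B $ j)\<^sup>2 \<le> (norm (A $ i))\<^sup>2 * (norm (transpose B $ j))\<^sup>2"
      by (metis abs_ge_zero power2_abs power_mono power_mult_distrib)
  qed
  also have "\<dots> = (norm A)\<^sup>2 * (norm (transpose B))\<^sup>2"
    by (simp add: power2_norm_eq_inner inner_vec_def[of A] inner_vec_def[of "transpose B"]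
        sum_product)
  finally show ?thesis
    by (metis norm_transpose power2_le_imp_le power_mult_distrib mult_nonneg_nonneg norm_ge_zero)
qed

lemma matrix_mult_scaleR:
  fixes A :: "real ^ 'b ^ 'a" and B :: "real ^ 'c ^ 'b"
  shows "(c *\<^sub>R A) ** B = c *\<^sub>R (A ** B)" "A ** (c *\<^sub>R B) = c *\<^sub>R (A ** B)"
  by (simp_all add: matrix_matrix_mult_def vec_eq_iff sum_distrib_left algebra_simps)

text \<open>Through this fact the general rules for limits and derivatives of bounded bilinear maps
  apply to matrix products.\<close>

lemma bounded_bilinear_matrix_mult:
  "bounded_bilinear ((**) :: real ^ 'b ^ 'a \<Rightarrow> real ^ 'c ^ 'b \<Rightarrow> real ^ 'c ^ 'a)"
proof
  show "(A + A') ** B = A ** B + A' ** B" for A A' :: "real ^ 'b ^ 'a" and B :: "real ^ 'c ^ 'b"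
    by (simp add: matrix_matrix_mult_def vec_eq_iff sum.distrib algebra_simps)
  show "\<exists>K. \<forall>(A :: real ^ 'b ^ 'a) (B :: real ^ 'c ^ 'b). norm (A ** B) \<le> norm A * norm B * K"
    by (rule exI[of _ 1]) (simp add: norm_matrix_mult_le)
qed (simp_all add: matrix_mult_scaleR matrix_add_ldistrib)

interpretation matrix_mult: bounded_bilinear "(**) :: real ^ 'b ^ 'a \<Rightarrow> real ^ 'c ^ 'b \<Rightarrow> real ^ 'c ^ 'a"
  by (rule bounded_bilinear_matrix_mult)

lemma bounded_linear_transpose:
  "bounded_linear (transpose :: real ^ 'b ^ 'a \<Rightarrow> real ^ 'a ^ 'b)"
  by (intro linear_conv_bounded_linear[THEN iffD1] linearI)
    (simp_all add: transpose_def vec_eq_iff)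

lemmas transpose_add = linear_add[OF bounded_linear.linear[OF bounded_linear_transpose]]
lemmas transpose_diff = linear_diff[OF bounded_linear.linear[OF bounded_linear_transpose]]
lemmas transpose_minus = linear_neg[OF bounded_linear.linear[OF bounded_linear_transpose]]
lemmas transpose_sum = linear_sum[OF bounded_linear.linear[OF bounded_linear_transpose]]

lemma norm_mult_orthogonal:
  fixes Q :: "real ^ 'a ^ 'a"
  assumes "orthogonal_matrix Q"
  shows "norm (Q ** A) = norm A" "norm (B ** Q) = norm B"
proof -
  have 1: "transpose Q ** Q = mat 1" "Q ** transpose Q = mat 1"
    using assms by (simp_all add: orthogonal_matrix_def)
  show "norm (Q ** A) = norm A"
    by (simp add: norm_eq_sqrt_inner inner_matrix_mult_left matrix_mul_assoc 1)
  show "norm (B ** Q) = norm B"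
    by (simp add: norm_eq_sqrt_inner inner_matrix_mult_right 1 flip: matrix_mul_assoc)
qed

text \<open>The Frobenius norm of the identity is the square root of \<open>d\<close>, not 1; hence
  the factor \<open>norm (mat 1)\<close> in the bounds on the exponential and the
  retraction.\<close>

lemma norm_orthogonal_matrix:
  fixes Q :: "real ^ 'a ^ 'a"
  assumes "orthogonal_matrix Q"
  shows "norm Q = norm (mat 1 :: real ^ 'a ^ 'a)"
  using norm_mult_orthogonal(1)[OF assms, of "mat 1"] by simp

subsection \<open>The matrix exponential\<close>

lemma norm_matrix_power_le:
  "norm ((((**) A) ^^ k) (mat 1)) \<le> norm A ^ k * norm (mat 1 :: real ^ 'd ^ 'd)"
  for A :: "real ^ 'd ^ 'd"
proof (induction k)
  case (Suc k)
  have "norm ((((**) A) ^^ Suc k) (mat 1)) \<le> norm A * norm ((((**) A) ^^ k) (mat 1))"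
    by (simp add: norm_matrix_mult_le)
  also have "\<dots> \<le> norm A * (norm A ^ k * norm (mat 1 :: real ^ 'd ^ 'd))"
    by (intro mult_left_mono Suc) simp
  finally show ?case by (simp add: mult_ac)
qed simp

lemma matrix_power_scaleR:
  "(((**) (t *\<^sub>R A)) ^^ k) (mat 1) = t ^ k *\<^sub>R (((**) A) ^^ k) (mat 1)" for A :: "real ^ 'd ^ 'd"
  by (induction k) (simp_all add: matrix_mult_scaleR mult_ac)

lemma summable_matrix_exp:
  "summable (\<lambda>k. (1 / fact k) *\<^sub>R (((**) A) ^^ k) (mat 1))" for A :: "real ^ 'd ^ 'd"
proof (rule summable_comparison_test)
  let ?m = "norm (mat 1 :: real ^ 'd ^ 'd)"
  show "summable (\<lambda>k. (norm A ^ k /\<^sub>R fact k) * ?m)"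
    by (intro summable_mult2 summable_exp_generic)
  have "norm ((1 / fact k) *\<^sub>R (((**) A) ^^ k) (mat 1)) \<le> (norm A ^ k /\<^sub>R fact k) * ?m" for k
    using norm_matrix_power_le[of k A]
    by (simp add: divide_simps)
  then show "\<exists>N. \<forall>k\<ge>N. norm ((1 / fact k) *\<^sub>R (((**) A) ^^ k) (mat 1)) \<le> (norm A ^ k /\<^sub>R fact k) * ?m"
    by blast
qed

lemma matrix_exp_0: "matrix_exp 0 = mat 1"
proof -
  have "(\<lambda>k. (1 / fact k) *\<^sub>R (((**) (0 :: real ^ 'd ^ 'd)) ^^ k) (mat 1)) sums (mat 1)"
    using sums_single[of 0 "\<lambda>_. mat 1 :: real ^ 'd ^ 'd"]
  proof (rule sums_cong[THEN iffD1, rotated])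
    fix k
    show "(if k = 0 then mat 1 else 0) = (1 / fact k) *\<^sub>R (((**) (0 :: real ^ 'd ^ 'd)) ^^ k) (mat 1)"
      by (cases k) simp_all
  qed
  then show ?thesis unfolding matrix_exp_def by (rule sums_unique[symmetric])
qed

text \<open>On a line through 0 the exponential is a power series in \<open>t\<close> with matrix
  coefficients \<open>p k\<close>. Paired with a basis matrix \<open>e\<close> it becomes a real
  power series that converges everywhere and may be differentiated termwise; \<open>p_Suc\<close>
  turns the shifted coefficients into multiplication by \<open>A\<close>.\<close>

lemma matrix_exp_has_vector_derivative:
  fixes A :: "real ^ 'd ^ 'd"
  shows "((\<lambda>t. matrix_exp (t *\<^sub>R A)) has_vector_derivative A ** matrix_exp (t *\<^sub>R A)) (at t within T)"
proof -
  define p where "p k = (1 / fact k) *\<^sub>R (((**) A) ^^ k) (mat 1)" for k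
  have term_eq: "(1 / fact k) *\<^sub>R (((**) (s *\<^sub>R A)) ^^ k) (mat 1) = s ^ k *\<^sub>R p k" for s k
    by (simp add: p_def matrix_power_scaleR)
  have sm: "summable (\<lambda>k. s ^ k *\<^sub>R p k)" for s
    using summable_matrix_exp[of "s *\<^sub>R A"] by (simp add: term_eq)
  have exp_eq: "matrix_exp (s *\<^sub>R A) = (\<Sum>k. s ^ k *\<^sub>R p k)" for s
    by (simp add: matrix_exp_def term_eq)
  have p_Suc: "real (Suc k) *\<^sub>R p (Suc k) = A ** p k" for k
    by (simp add: p_def matrix_mult_scaleR)
  have "((\<lambda>s. matrix_exp (s *\<^sub>R A)) has_derivative (\<lambda>h. h *\<^sub>R (A ** matrix_exp (t *\<^sub>R A)))) (at t)"
  proof (rule has_derivative_componentwise_within[THEN iffD2], rule ballI)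
    fix e :: "real ^ 'd ^ 'd"
    define c where "c k = p k \<bullet> e" for k
    have csm: "summable (\<lambda>k. c k * s ^ k)" for s
      using bounded_linear.summable[OF bounded_linear_inner_left[of e] sm[of s]]
      by (simp add: c_def mult_ac)
    have ceq: "matrix_exp (s *\<^sub>R A) \<bullet> e = (\<Sum>k. c k * s ^ k)" for s
      using bounded_linear.suminf[OF bounded_linear_inner_left[of e] sm[of s]]
      by (simp add: exp_eq c_def mult_ac)
    have "((\<lambda>s. \<Sum>k. c k * s ^ k) has_field_derivative (\<Sum>k. diffs c k * t ^ k)) (at t)"
      by (rule termdiffs_strong_converges_everywhere[OF csm])
    also have "(\<Sum>k. diffs c k * t ^ k) = (\<Sum>k. (A ** (t ^ k *\<^sub>R p k)) \<bullet> e)"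
    proof (rule suminf_cong)
      fix k
      have "diffs c k = (A ** p k) \<bullet> e"
        unfolding p_Suc[symmetric] by (simp add: diffs_def c_def)
      then show "diffs c k * t ^ k = (A ** (t ^ k *\<^sub>R p k)) \<bullet> e"
        by (simp add: matrix_mult_scaleR)
    qed
    also have "\<dots> = (A ** matrix_exp (t *\<^sub>R A)) \<bullet> e"
      unfolding exp_eq
      by (rule bounded_linear.suminf[OF bounded_linear_compose[OF bounded_linear_inner_left
            matrix_mult.bounded_linear_right] sm, symmetric])
    finally have deriv: "((\<lambda>s. \<Sum>k. c k * s ^ k) has_field_derivative (A ** matrix_exp (t *\<^sub>R A)) \<bullet> e) (at t)" .
    show "((\<lambda>s. matrix_exp (s *\<^sub>R A) \<bullet> e) has_derivative
        (\<lambda>h. (h *\<^sub>R (A ** matrix_exp (t *\<^sub>R A))) \<bullet> e)) (at t)"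
      unfolding ceq
      by (rule has_derivative_eq_rhs[OF deriv[unfolded has_field_derivative_def]])
        (simp add: fun_eq_iff)
  qed
  then show ?thesis
    unfolding has_vector_derivative_def by (rule has_derivative_at_withinI)
qed

text \<open>Along \<open>Y t = matrix_exp (t *\<^sub>R A)\<close> the derivative of
  \<open>transpose (Y t) ** Y t\<close> cancels because \<open>A\<close> is skew, so the product
  keeps its value \<open>mat 1\<close> from \<open>t = 0\<close>. No functional equation of the
  exponential is involved.\<close>

lemma orthogonal_matrix_exp:
  fixes A :: "real ^ 'd ^ 'd"
  assumes skew: "transpose A = - A"
  shows "orthogonal_matrix (matrix_exp A)"
proof -
  define Y where "Y t = matrix_exp (t *\<^sub>R A)" for t
  have Y: "(Y has_vector_derivative A ** Y t) (at t within UNIV)" for t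
    unfolding Y_def[abs_def] by (rule matrix_exp_has_vector_derivative)
  have deriv0: "((\<lambda>t. transpose (Y t) ** Y t) has_vector_derivative 0) (at t within UNIV)" for t
  proof -
    have "((\<lambda>t. transpose (Y t)) has_vector_derivative transpose (A ** Y t)) (at t)"
      using bounded_linear.has_vector_derivative[OF bounded_linear_transpose Y] by simp
    from matrix_mult.has_vector_derivative[OF this Y[of t]]
    have "((\<lambda>t. transpose (Y t) ** Y t) has_vector_derivative
        transpose (Y t) ** (A ** Y t) + transpose (A ** Y t) ** Y t) (at t)"
      by simp
    also have "transpose (Y t) ** (A ** Y t) + transpose (A ** Y t) ** Y t = 0"
      by (simp add: matrix_transpose_mul skew matrix_mult.minus_left matrix_mult.minus_right
          flip: matrix_mul_assoc)
    finally show ?thesis by simp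
  qed
  have "transpose (Y 1) ** Y 1 = transpose (Y 0) ** Y 0"
    using has_vector_derivative_zero_constant[OF convex_UNIV deriv0]
    by (metis UNIV_I)
  then show ?thesis
    by (simp add: Y_def matrix_exp_0 orthogonal_matrix)
qed

text \<open>Mean value inequality on a curve of orthogonal matrices: the speed
  \<open>norm (A ** Y u)\<close> is bounded uniformly in \<open>u\<close>, so no factor exponential
  in \<open>t\<close> appears and the estimates are not restricted to small \<open>t\<close>. The
  Taylor remainder has derivative \<open>A ** (Y u - mat 1)\<close>, to which the other estimate
  applies.\<close>

lemma
  fixes A :: "real ^ 'd ^ 'd"
  assumes skew: "transpose A = - A" and t: "0 \<le> t"
  shows norm_matrix_exp_minus_id: 
      "norm (matrix_exp (t *\<^sub>R A) - mat 1) \<le> t * norm A * norm (mat 1 :: real ^ 'd ^ 'd)"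
    and norm_matrix_exp_taylor:
      "norm (matrix_exp (t *\<^sub>R A) - mat 1 - t *\<^sub>R A) \<le> (t * norm A)\<^sup>2 * norm (mat 1 :: real ^ 'd ^ 'd)"
proof -
  define Y where "Y t = matrix_exp (t *\<^sub>R A)" for t
  let ?m = "norm (mat 1 :: real ^ 'd ^ 'd)"
  have Y: "(Y has_vector_derivative A ** Y t) (at t within T)" for t T
    unfolding Y_def[abs_def] by (rule matrix_exp_has_vector_derivative)
  have orth: "orthogonal_matrix (Y s)" for s
    unfolding Y_def using skew by (intro orthogonal_matrix_exp) (simp add: transpose_scalar)
  have Y0: "Y 0 = mat 1" by (simp add: Y_def matrix_exp_0)
  have "norm (Y s - mat 1) \<le> s * norm A * ?m" if "0 \<le> s" for s
  proof -
    have "norm (Y s - Y 0) \<le> (norm A * ?m) * norm (s - 0)"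
    proof (rule differentiable_bound[where S = "{0..s}" and f = Y and f' = "\<lambda>u h. h *\<^sub>R (A ** Y u)"])
      fix u
      have "norm (A ** Y u) \<le> norm A * ?m"
        using norm_matrix_mult_le[of A "Y u"] norm_orthogonal_matrix[OF orth] by simp
      then show "onorm (\<lambda>h. h *\<^sub>R (A ** Y u)) \<le> norm A * ?m"
        by (intro onorm_le) (simp add: mult_ac mult_left_mono)
      show "(Y has_derivative (\<lambda>h. h *\<^sub>R (A ** Y u))) (at u within {0..s})"
        using Y unfolding has_vector_derivative_def .
    qed (use that in auto)
    then show ?thesis using that by (simp add: Y0 mult_ac)
  qed
  note * = this
  show "norm (matrix_exp (t *\<^sub>R A) - mat 1) \<le> t * norm A * ?m"
    using *[OF t] by (simp add: Y_def)
  define R where "R u = Y u - mat 1 - u *\<^sub>R A" for u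
  have R0: "R 0 = 0" by (simp add: R_def Y0)
  have R': "(R has_vector_derivative A ** (Y u - mat 1)) (at u within {0..t})" for u
    unfolding R_def[abs_def]
    by (rule derivative_eq_intros Y refl | simp add: matrix_mult.diff_right)+
  have "norm (R t - R 0) \<le> (norm A * (t * norm A * ?m)) * norm (t - 0)"
  proof (rule differentiable_bound[where S = "{0..t}" and f = R and f' = "\<lambda>u h. h *\<^sub>R (A ** (Y u - mat 1))"])
    fix u assume u: "u \<in> {0..t}"
    have "norm (A ** (Y u - mat 1)) \<le> norm A * norm (Y u - mat 1)"
      by (rule norm_matrix_mult_le)
    also have "\<dots> \<le> norm A * (t * norm A * ?m)"
    proof (rule mult_left_mono)
      have "norm (Y u - mat 1) \<le> u * norm A * ?m" using * u by simp
      also have "\<dots> \<le> t * norm A * ?m" using u by (intro mult_right_mono) auto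
      finally show "norm (Y u - mat 1) \<le> t * norm A * ?m" .
    qed simp
    finally have "\<bar>h\<bar> * norm (A ** (Y u - mat 1)) \<le> \<bar>h\<bar> * (norm A * (t * norm A * ?m))" for h :: real
      by (rule mult_left_mono) simp
    then show "onorm (\<lambda>h. h *\<^sub>R (A ** (Y u - mat 1))) \<le> norm A * (t * norm A * ?m)"
      by (intro onorm_le) (simp add: mult.commute)
    show "(R has_derivative (\<lambda>h. h *\<^sub>R (A ** (Y u - mat 1)))) (at u within {0..t})"
      using R' unfolding has_vector_derivative_def .
  qed (use t in auto)
  then show "norm (matrix_exp (t *\<^sub>R A) - mat 1 - t *\<^sub>R A) \<le> (t * norm A)\<^sup>2 * ?m"
    using t unfolding R0 by (simp add: R_def Y_def power2_eq_square mult_ac)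
qed

subsection \<open>The Moore--Penrose inverse of a symmetric matrix\<close>

text \<open>\<open>A ** X\<close> and \<open>A ** Y\<close> are both the orthogonal projection onto
  the range of \<open>A\<close>, hence equal; likewise \<open>X ** A\<close> and
  \<open>Y ** A\<close>. So \<open>X = X ** A ** X\<close> may be rewritten factor by factor into
  \<open>Y ** A ** Y\<close>.\<close>

lemma moore_penrose_unique:
  fixes A :: "real ^ 'b ^ 'a"
  assumes "A ** X ** A = A" "X ** A ** X = X" "transpose (A ** X) = A ** X" "transpose (X ** A) = X ** A"
    and "A ** Y ** A = A" "Y ** A ** Y = Y" "transpose (A ** Y) = A ** Y" "transpose (Y ** A) = Y ** A"
  shows "X = Y"
proof -
  have "(A ** Y) ** (A ** X) = A ** X"
    by (simp add: matrix_mul_assoc assms(5))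
  then have "A ** X = transpose ((A ** Y) ** (A ** X))"
    by (simp add: assms(3))
  also have "\<dots> = (A ** X) ** (A ** Y)"
    by (simp only: matrix_transpose_mul[of "A ** Y"] assms(3,7))
  also have "\<dots> = A ** Y"
    by (simp add: matrix_mul_assoc assms(1))
  finally have 1: "A ** X = A ** Y" .
  have "(X ** A) ** (Y ** A) = X ** (A ** Y ** A)"
    by (simp only: matrix_mul_assoc)
  then have "X ** A = transpose ((X ** A) ** (Y ** A))"
    by (simp only: assms(4,5))
  also have "\<dots> = (Y ** A) ** (X ** A)"
    by (simp only: matrix_transpose_mul[of "X ** A"] assms(4,8))
  also have "\<dots> = Y ** (A ** X ** A)"
    by (simp only: matrix_mul_assoc)
  finally have 2: "X ** A = Y ** A"
    by (simp only: assms(1))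
  have "X = (Y ** A) ** X"
    by (simp only: 2[symmetric] assms(2))
  also have "\<dots> = Y ** (A ** Y)"
    by (simp only: 1[symmetric] matrix_mul_assoc)
  finally show ?thesis
    by (simp only: matrix_mul_assoc assms(6))
qed

text \<open>A solution \<open>Y\<close> of \<open>A ** A ** Y = A\<close> takes the place of an
  eigenbasis. By symmetry \<open>P = A ** Y\<close> is the orthogonal projection onto the range of
  \<open>A\<close>, and \<open>P ** Y\<close>, the part of \<open>Y\<close> inside that range, is
  the pseudoinverse.\<close>

lemma moore_penrose_exists_symmetric:
  fixes A :: "real ^ 'a ^ 'a"
  assumes sym: "transpose A = A"
  shows "\<exists>X. A ** X ** A = A \<and> X ** A ** X = X \<and> transpose (A ** X) = A ** X \<and> transpose (X ** A) = X ** A"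
proof -
  \<comment> \<open>Since \<open>ker A\<^sup>2 = ker A\<close>, the columns of \<open>A\<close> lie in the range of \<open>A\<^sup>2\<close>.\<close>
  have ex: "\<exists>y. A *v v = (A ** A) *v y" for v
  proof -
    let ?R = "range ((*v) (A ** A))"
    have sub: "subspace ?R"
      by (intro linear_subspace_image) auto
    obtain s w where s: "s \<in> span ?R" and w: "\<And>u. u \<in> span ?R \<Longrightarrow> orthogonal w u"
      and v: "A *v v = s + w"
      using orthogonal_subspace_decomp_exists by blast
    obtain y where y: "s = (A ** A) *v y"
      using s unfolding span_eq_iff[THEN iffD2, OF sub] by blast
    have adj: "(A *v a) \<bullet> b = a \<bullet> (A *v b)" for a b
      using transpose_matrix_vector[of A a] by (simp add: sym dot_lmul_matrix)
    \<comment> \<open>Since \<open>w\<close> is orthogonal to the range of \<open>A ** A\<close>,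
      symmetry gives \<open>A (A w) = 0\<close> and in turn \<open>A w = 0\<close>. As a difference
      of two vectors in the range of \<open>A\<close>, \<open>w\<close> also lies in that range,
      which is orthogonal to the kernel; hence \<open>w = 0\<close>.\<close>
    have "(A *v (A *v w)) \<bullet> (A *v (A *v w)) = w \<bullet> ((A ** A) *v (A *v (A *v w)))"
      by (simp add: adj flip: matrix_vector_mul_assoc)
    also have "\<dots> = 0"
      using w[OF span_base[OF rangeI]] unfolding orthogonal_def by simp
    finally have "A *v (A *v w) = 0" by simp
    then have "(A *v w) \<bullet> (A *v w) = 0"
      by (simp add: adj)
    then have Aw: "A *v w = 0" by simp
    have w_eq: "w = A *v (v - A *v y)"
      using v y by (simp add: matrix_vector_mult_diff_distrib matrix_vector_mul_assoc)
    have "w \<bullet> w = (A *v w) \<bullet> (v - A *v y)"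
      unfolding adj by (rule arg_cong[OF w_eq])
    then have "w = 0" by (simp add: Aw)
    then show ?thesis using v y by auto
  qed
  then obtain y where y: "\<And>v. A *v v = (A ** A) *v (y v)" by metis
  define Y where "Y = (\<chi> i j. y (axis j 1) $ i)"
  have "A ** A ** Y = A"
  proof -
    have "(A ** A ** Y) $ i $ j = A $ i $ j" for i j
    proof -
      have "(A ** A ** Y) $ i $ j = ((A ** A) *v y (axis j 1)) $ i"
        by (simp add: matrix_matrix_mult_def[of "A ** A"] matrix_vector_mult_def Y_def)
      also have "\<dots> = A $ i $ j"
        by (simp add: y[symmetric] matrix_vector_mult_basis column_def)
      finally show ?thesis .
    qed
    then show ?thesis by (simp add: vec_eq_iff)
  qed
  then have AAY: "A ** (A ** Y) = A" by (simp add: matrix_mul_assoc)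
  define Z where "Z = transpose Y"
  have "transpose (A ** (A ** Y)) = transpose A" by (simp only: AAY)
  then have ZAA: "Z ** A ** A = A"
    by (simp add: Z_def matrix_transpose_mul sym)
  define P where "P = A ** Y"
  have "Z ** (A ** (A ** Y)) = Z ** A ** A ** Y"
    by (simp only: matrix_mul_assoc)
  then have P: "P = Z ** A"
    by (simp only: AAY ZAA P_def)
  have tP: "transpose P = P"
    by (simp add: P_def matrix_transpose_mul sym flip: Z_def) (simp add: P flip: P_def)
  have PA: "P ** A = A"
    by (simp add: P ZAA)
  have AP: "A ** P = A"
    by (simp add: P_def AAY)
  have PP: "P ** P = P"
    by (subst (2) P_def) (simp add: matrix_mul_assoc PA, simp add: P_def)
  define X where "X = P ** Y"
  have "X = Z ** A ** Y"
    by (simp only: X_def P)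
  also have "\<dots> = Z ** P"
    by (simp only: P_def matrix_mul_assoc)
  finally have XZ: "X = Z ** P" .
  have AX: "A ** X = P"
    by (simp add: X_def matrix_mul_assoc AP, simp add: P_def)
  have XA: "X ** A = P"
    by (simp add: XZ PA flip: matrix_mul_assoc, simp add: P)
  have XAX: "X ** A ** X = X"
    by (simp add: XA, simp add: X_def matrix_mul_assoc PP)
  show ?thesis
  proof (rule exI[of _ X], intro conjI)
    show "A ** X ** A = A" by (simp only: AX PA)
    show "X ** A ** X = X" by (rule XAX)
    show "transpose (A ** X) = A ** X" by (simp only: AX tP)
    show "transpose (X ** A) = X ** A" by (simp only: XA tP)
  qed
qed

text \<open>For symmetric \<open>A\<close> the Penrose conditions are stable under transposing
  \<open>X\<close>, so uniqueness applies. Existence enters because the pseudoinverse is defined by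
  \<open>THE\<close>.\<close>

lemma transpose_moore_penrose:
  fixes A :: "real ^ 'a ^ 'a"
  assumes sym: "transpose A = A"
  shows "transpose (moore_penrose A) = moore_penrose A"
proof -
  define P where "P X \<longleftrightarrow> A ** X ** A = A \<and> X ** A ** X = X \<and>
    transpose (A ** X) = A ** X \<and> transpose (X ** A) = X ** A" for X
  have uniq: "X = Y" if "P X" "P Y" for X Y
    using that unfolding P_def by (elim conjE) (rule moore_penrose_unique[of A])
  have "\<exists>X. P X"
    unfolding P_def by (rule moore_penrose_exists_symmetric[OF sym])
  then have "P (THE X. P X)"
    by (rule theI'[OF ex_ex1I]) (rule uniq)
  then have "P (moore_penrose A)"
    by (simp only: moore_penrose_def P_def)
  then have PX: "A ** moore_penrose A ** A = A \<and> moore_penrose A ** A ** moore_penrose A = moore_penrose A \<and>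
    transpose (A ** moore_penrose A) = A ** moore_penrose A \<and>
    transpose (moore_penrose A ** A) = moore_penrose A ** A"
    by (simp only: P_def)
  note X = PX[THEN conjunct1] PX[THEN conjunct2, THEN conjunct1]
    PX[THEN conjunct2, THEN conjunct2, THEN conjunct1] PX[THEN conjunct2, THEN conjunct2, THEN conjunct2]
  let ?X = "moore_penrose A" and ?T = "transpose (moore_penrose A)"
  have AT: "A ** ?T = transpose (?X ** A)" and TA: "?T ** A = transpose (A ** ?X)"
    by (simp_all only: matrix_transpose_mul sym)
  have "A ** ?T ** A = transpose (A ** ?X ** A)" "?T ** A ** ?T = transpose (?X ** A ** ?X)"
    by (simp_all only: matrix_transpose_mul sym matrix_mul_assoc)
  then have "P ?T"
    by (simp only: P_def AT TA X transpose_transpose sym)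
  then show ?thesis
    using \<open>P (moore_penrose A)\<close> by (rule uniq)
qed

section \<open>Symmetry of the matrix C\<close>

lemma transpose_outer: "transpose (outer u v) = outer v u"
  by (simp add: outer_def transpose_def vec_eq_iff mult.commute)

text \<open>Symmetry is what makes \<open>2 C S\<close> the Euclidean gradient of the
  objective.\<close>

lemma transpose_C_mat: "transpose (C_mat E x) = C_mat E x"
proof -
  have L: "transpose (laplacian E) = laplacian E"
    by (simp add: laplacian_def transpose_sum transpose_outer case_prod_beta)
  have D: "transpose (D_mat E x) = D_mat E x"
    by (simp add: D_mat_def transpose_sum transpose_outer case_prod_beta matrix_transpose_mul
        matrix_mul_assoc)
  show ?thesis
    unfolding C_mat_def
    by (simp only: transpose_diff matrix_transpose_mul transpose_transpose D
        transpose_moore_penrose[OF L] matrix_mul_assoc)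
qed

subsection \<open>Linear convergence from gradient domination\<close>

text \<open>\<open>a\<close> stands for the excess of the objective and \<open>s\<close> for the
  gradient norm. Since \<open>s k\<close> is at most the square root of
  \<open>a k / \<delta>\<close>, contraction of \<open>a\<close> with ratio \<open>r\<close> makes
  the steps shrink with ratio \<open>sqrt r\<close>, and the tail of a geometric series bounds the
  distance to \<open>p\<close>.\<close>

lemma linear_convergence_of_gradient_dominated:
  fixes X :: "nat \<Rightarrow> 'a::real_normed_vector" and a s :: "nat \<Rightarrow> real"
  assumes lim: "X \<longlonglongrightarrow> p" and "0 < \<delta>" "0 \<le> b"
    and a: "\<And>k. 0 \<le> a k"
    and decr: "\<And>k. \<delta> * (s k)\<^sup>2 \<le> a k - a (Suc k)"
    and step: "\<And>k. norm (X (Suc k) - X k) \<le> b * s k"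
    and dom: "\<forall>\<^sub>F k in sequentially. a k \<le> c * (s k)\<^sup>2"
  shows "linear_convergence X p"
proof -
  obtain N where N: "\<And>k. N \<le> k \<Longrightarrow> a k \<le> c * (s k)\<^sup>2"
    using dom unfolding eventually_sequentially by blast
  \<comment> \<open>The maximum keeps \<open>\<delta> / c'\<close> at most \<open>1 / 2\<close>, so
    that \<open>r\<close> and its root \<open>q\<close> are strictly positive whatever
    \<open>c\<close> is.\<close>
  define c' where "c' = max c (2 * \<delta>)"
  define r where "r = 1 - \<delta> / c'"
  define q where "q = sqrt r"
  have c': "0 < c'" "c \<le> c'" "2 * \<delta> \<le> c'" using \<open>0 < \<delta>\<close> by (auto simp: c'_def)
  have "\<delta> / c' \<le> 1 / 2" "0 < \<delta> / c'" using c' \<open>0 < \<delta>\<close> by (simp_all add: field_simps)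
  then have r: "0 < r" "r < 1" unfolding r_def by linarith+
  then have q: "0 < q" "q < 1" by (simp_all add: q_def)
  have a_step: "a (Suc k) \<le> r * a k" if "N \<le> k" for k
  proof -
    have "a k \<le> c' * (s k)\<^sup>2"
      using N[OF that] c'(2) by (meson order_trans mult_right_mono zero_le_power2)
    then have "(\<delta> / c') * a k \<le> \<delta> * (s k)\<^sup>2"
      using c'(1) \<open>0 < \<delta>\<close> by (simp add: field_simps)
    then show ?thesis using decr[of k] by (simp add: r_def algebra_simps)
  qed
  have a_geo: "a (N + j) \<le> r ^ j * a N" for j
  proof (induction j)
    case (Suc j)
    have "a (N + Suc j) \<le> r * a (N + j)" using a_step[of "N + j"] by simp
    also have "\<dots> \<le> r * (r ^ j * a N)" using Suc r by (intro mult_left_mono) auto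
    finally show ?case by (simp add: mult_ac)
  qed simp
  define M where "M = b * sqrt (a N / \<delta>)"
  have M: "0 \<le> M" using \<open>0 \<le> b\<close> \<open>0 < \<delta>\<close> a by (simp add: M_def)
  have step_geo: "norm (X (Suc (N + j)) - X (N + j)) \<le> M * q ^ j" for j
  proof -
    have "\<delta> * (s (N + j))\<^sup>2 \<le> r ^ j * a N"
      using decr[of "N + j"] a[of "Suc (N + j)"] a_geo[of j] by linarith
    then have "(s (N + j))\<^sup>2 \<le> a N / \<delta> * r ^ j"
      using \<open>0 < \<delta>\<close> by (simp add: field_simps)
    then have "s (N + j) \<le> sqrt (a N / \<delta> * r ^ j)"
      by (rule real_le_rsqrt)
    then have "s (N + j) \<le> sqrt (a N / \<delta>) * q ^ j"
      by (simp only: real_sqrt_mult real_sqrt_power q_def)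
    then have "b * s (N + j) \<le> M * q ^ j"
      using \<open>0 \<le> b\<close> unfolding M_def mult.assoc by (rule mult_left_mono)
    then show ?thesis using step[of "N + j"] by linarith
  qed
  have tele: "norm (X (N + (j + n)) - X (N + j)) \<le> M * q ^ j * ((1 - q ^ n) / (1 - q))" for j n
  proof (induction n)
    case (Suc n)
    have "norm (X (N + (j + Suc n)) - X (N + j)) \<le>
        norm (X (Suc (N + (j + n))) - X (N + (j + n))) + norm (X (N + (j + n)) - X (N + j))"
      using norm_triangle_ineq[of "X (Suc (N + (j + n))) - X (N + (j + n))" "X (N + (j + n)) - X (N + j)"]
      by simp
    also have "\<dots> \<le> M * q ^ (j + n) + M * q ^ j * ((1 - q ^ n) / (1 - q))"
      by (intro add_mono step_geo Suc)
    also have "\<dots> = M * q ^ j * (q ^ n + (1 - q ^ n) / (1 - q))"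
      by (simp add: power_add algebra_simps)
    also have "q ^ n + (1 - q ^ n) / (1 - q) = (1 - q ^ Suc n) / (1 - q)"
      using q by (simp add: field_simps)
    finally show ?case .
  qed simp
  have tail: "norm (X (N + j) - p) \<le> M / (1 - q) * q ^ j" for j
  proof -
    have "(\<lambda>n. norm (X (N + (j + n)) - X (N + j))) \<longlonglongrightarrow> norm (p - X (N + j))"
      using LIMSEQ_ignore_initial_segment[OF lim, of "N + j"]
      by (intro tendsto_intros) (simp add: add_ac)
    moreover have "norm (X (N + (j + n)) - X (N + j)) \<le> M / (1 - q) * q ^ j" for n
    proof -
      have "M * q ^ j * ((1 - q ^ n) / (1 - q)) \<le> M * q ^ j * (1 / (1 - q))"
        using q M by (intro mult_left_mono divide_right_mono) auto
      then show ?thesis using tele[of j n] by simp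
    qed
    ultimately have "norm (p - X (N + j)) \<le> M / (1 - q) * q ^ j"
      by (intro Lim_bounded[where M = 0]) auto
    then show ?thesis by (simp add: norm_minus_commute)
  qed
  \<comment> \<open>The finitely many terms before \<open>N\<close> are absorbed into the constant;
    \<open>+ 1\<close> keeps it positive even if every other summand vanishes.\<close>
  define A where "A = M / (1 - q) + (\<Sum>i<N. norm (X i - p)) + 1"
  have A: "0 < A" "M / (1 - q) \<le> A" "\<And>k. k < N \<Longrightarrow> norm (X k - p) \<le> A"
  proof -
    have 1: "0 \<le> M / (1 - q)" using M q by simp
    have 2: "0 \<le> (\<Sum>i<N. norm (X i - p))" by (simp add: sum_nonneg)
    show "0 < A" "M / (1 - q) \<le> A" using 1 2 by (simp_all add: A_def)
    show "norm (X k - p) \<le> A" if "k < N" for k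
      using member_le_sum[of k "{..<N}" "\<lambda>i. norm (X i - p)"] that 1 by (simp add: A_def)
  qed
  have "norm (X k - p) \<le> A / q ^ N * q ^ k" for k
  proof (cases "k < N")
    case True
    then have "q ^ N \<le> q ^ k" using q by (intro power_decreasing) auto
    then have "A * q ^ N \<le> A * q ^ k" using A(1) by simp
    then have "A \<le> A / q ^ N * q ^ k" using q by (simp add: field_simps)
    then show ?thesis using A(3)[OF True] by linarith
  next
    case False
    then obtain j where k: "k = N + j" using le_Suc_ex linorder_not_less by blast
    have "norm (X k - p) \<le> A * q ^ j"
      unfolding k using tail[of j] A(2) q by (meson order_trans mult_right_mono zero_le_power less_imp_le)
    then show ?thesis using q by (simp add: k power_add)
  qed
  moreover have "0 < A / q ^ N" using A q by simp
  ultimately show ?thesis unfolding linear_convergence_def using q by blast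
qed

subsection \<open>Stacks and their blocks\<close>

lemma block_add [simp]: "block (A + B) i = block A i + block B i"
  and block_diff [simp]: "block (A - B) i = block A i - block B i"
  and block_minus [simp]: "block (- A) i = - block A i"
  and block_scaleR [simp]: "block (c *\<^sub>R A) i = c *\<^sub>R block A i"
  and block_zero [simp]: "block 0 i = 0"
  by (simp_all add: block_def vec_eq_iff)

lemma block_matrix_mult [simp]: "block (A ** Q) i = block A i ** Q"
  by (simp add: block_def matrix_matrix_mult_def vec_eq_iff)

lemma stack_eqI: "(\<And>i. block A i = block B i) \<Longrightarrow> A = B"
  by (metis stack_block ext)

lemma inner_block: "A \<bullet> B = (\<Sum>i\<in>UNIV. block A i \<bullet> block B i)"
  for A B :: "('m::finite, 'd::finite) stack"
proof -
  have "A \<bullet> B = (\<Sum>(i, a)\<in>UNIV \<times> UNIV. A $ (i, a) \<bullet> B $ (i, a))"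
    by (simp add: inner_vec_def[of A] case_prod_beta)
  also have "\<dots> = (\<Sum>i\<in>UNIV. \<Sum>a\<in>UNIV. A $ (i, a) \<bullet> B $ (i, a))"
    by (rule sum.cartesian_product[symmetric])
  also have "\<dots> = (\<Sum>i\<in>UNIV. block A i \<bullet> block B i)"
    by (simp add: inner_vec_def block_def)
  finally show ?thesis .
qed

lemma norm_block_le: "norm (block A i) \<le> norm A" for A :: "('m::finite, 'd::finite) stack"
proof -
  have "(norm (block A i))\<^sup>2 \<le> (\<Sum>j\<in>UNIV. (norm (block A j))\<^sup>2)"
    by (rule member_le_sum) auto
  also have "\<dots> = (norm A)\<^sup>2"
    by (simp add: power2_norm_eq_inner inner_block)
  finally show ?thesis by (rule power2_le_imp_le) simp
qed

lemma norm_stack_le: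
  fixes A :: "('m::finite, 'd::finite) stack" and c :: real
  assumes "\<And>i. norm (block A i) \<le> c"
  shows "norm A \<le> real CARD('m) * c"
proof -
  have "norm A = L2_set (\<lambda>j. norm (block A j)) UNIV"
    by (simp add: norm_eq_sqrt_inner[of A] inner_block L2_set_def power2_norm_eq_inner)
  also have "\<dots> \<le> (\<Sum>j\<in>UNIV. norm (block A j))"
    by (rule L2_set_le_sum) simp
  also have "\<dots> \<le> (\<Sum>j\<in>(UNIV :: 'm set). c)"
    by (intro sum_mono assms)
  finally show ?thesis by simp
qed

lemma bounded_linear_block: "bounded_linear (\<lambda>A. block A i)"
  for i :: "'m::finite"
  by (intro linear_conv_bounded_linear[THEN iffD1] linearI) simp_all

text \<open>A stack is the finite sum of its blocks, each put in place by the linear embedding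
  \<open>e j\<close>.\<close>

lemma differentiable_stack:
  fixes f :: "'m::finite \<Rightarrow> 'a::real_normed_vector \<Rightarrow> real ^ 'd ^ 'd"
  assumes "\<And>i. f i differentiable (at x)"
  shows "(\<lambda>y. stack (\<lambda>i. f i y)) differentiable (at x)"
proof -
  define e :: "'m \<Rightarrow> real ^ 'd ^ 'd \<Rightarrow> ('m, 'd) stack"
    where "e j M = stack (\<lambda>i. if i = j then M else 0)" for j M
  have lin: "bounded_linear (e j)" for j
    by (intro linear_conv_bounded_linear[THEN iffD1] linearI; rule stack_eqI) (simp_all add: e_def)
  have sum_block: "block (\<Sum>j\<in>J. g j) i = (\<Sum>j\<in>J. block (g j) i)"
    for J :: "'m set" and g :: "'m \<Rightarrow> ('m, 'd) stack" and i
    by (rule linear_sum[OF bounded_linear.linear[OF bounded_linear_block]])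
  have "stack g = (\<Sum>j\<in>UNIV. e j (g j))" for g :: "'m \<Rightarrow> real ^ 'd ^ 'd"
    by (rule stack_eqI) (simp add: sum_block e_def)
  moreover have "(\<lambda>y. e j (f j y)) differentiable (at x)" for j
    using assms[of j] bounded_linear.has_derivative[OF lin] unfolding differentiable_def by blast
  ultimately show ?thesis by (simp add: differentiable_sum)
qed

lemma differentiable_matrix_mult:
  fixes f :: "'a::real_normed_vector \<Rightarrow> real ^ 'c ^ 'b" and g :: "'a \<Rightarrow> real ^ 'd ^ 'c"
  assumes "f differentiable (at x)" "g differentiable (at x)"
  shows "(\<lambda>y. f y ** g y) differentiable (at x)"
  using assms matrix_mult.FDERIV unfolding differentiable_def by blast

subsection \<open>The objective along the retraction\<close>

lemma objective_eq_inner: "objective C S = S \<bullet> (C ** S)"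
proof -
  have "objective C S = trace (transpose S ** (C ** S))"
    unfolding objective_def by (simp add: matrix_mul_assoc trace_mul_sym[of _ "transpose S"])
  then show ?thesis by (simp add: trace_transpose_mult)
qed

text \<open>The objective is a quadratic form, so the expansion is exact and leaves no remainder to
  estimate.\<close>

lemma objective_add:
  assumes "transpose C = C"
  shows "objective C (S + D) = objective C S + 2 * ((C ** S) \<bullet> D) + D \<bullet> (C ** D)"
proof -
  have "S \<bullet> (C ** D) = (C ** S) \<bullet> D"
    by (metis assms inner_commute inner_matrix_mult_left)
  then show ?thesis
    by (simp add: objective_eq_inner matrix_add_ldistrib inner_add_left inner_add_right inner_commute[of D])
qed

lemma objective_mult_orthogonal:
  assumes "orthogonal_matrix Q"
  shows "objective C (S ** Q) = objective C S"
proof -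
  have "C ** (S ** Q) ** transpose Q = C ** S ** (Q ** transpose Q)"
    by (simp only: matrix_mul_assoc)
  then show ?thesis
    using assms by (simp add: objective_eq_inner inner_matrix_mult_right orthogonal_matrix_def)
qed

lemma block_grad_objective [simp]:
  "block (grad_objective C S) i =
     block (C ** S) i - block S i ** transpose (block (C ** S) i) ** block S i"
  by (simp add: grad_objective_def)

lemma block_retract [simp]:
  "block (retract S Z) i = block S i ** matrix_exp (transpose (block S i) ** block Z i)"
  by (simp add: retract_def)

text \<open>The gradient is the orthogonal projection of \<open>2 C S\<close> onto the tangent
  space, so pairing the two gives its own squared norm. Blockwise this comes down to
  \<open>Q ** transpose M ** Q\<close> having the norm of \<open>M\<close>.\<close>

lemma inner_grad_objective:
  fixes S :: "('m::finite, 'd::finite) stack"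
  assumes "S \<in> alignments"
  shows "2 * ((C ** S) \<bullet> grad_objective C S) = (norm (grad_objective C S))\<^sup>2"
proof -
  have "2 * (M \<bullet> (M - Q ** transpose M ** Q)) = (M - Q ** transpose M ** Q) \<bullet> (M - Q ** transpose M ** Q)"
    if "orthogonal_matrix Q" for M Q :: "real ^ 'd ^ 'd"
  proof -
    have "norm (Q ** transpose M ** Q) = norm M"
      using that by (simp add: norm_mult_orthogonal norm_transpose)
    then have "(Q ** transpose M ** Q) \<bullet> (Q ** transpose M ** Q) = M \<bullet> M"
      by (simp flip: power2_norm_eq_inner)
    then show ?thesis by (simp add: inner_diff_left inner_diff_right inner_commute)
  qed
  then have "2 * (block (C ** S) i \<bullet> block (grad_objective C S) i) =
      block (grad_objective C S) i \<bullet> block (grad_objective C S) i" for i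
    using assms by (simp add: alignments_def del: block_matrix_mult)
  then show ?thesis
    by (simp add: power2_norm_eq_inner inner_block sum_distrib_left del: block_grad_objective)
qed

lemma transpose_mult_grad_skew:
  fixes Q M :: "real ^ 'd ^ 'd"
  assumes "orthogonal_matrix Q"
  shows "transpose (transpose Q ** (M - Q ** transpose M ** Q)) = - (transpose Q ** (M - Q ** transpose M ** Q))"
proof -
  have 1: "transpose Q ** Q = mat 1" using assms by (simp add: orthogonal_matrix_def)
  have "transpose Q ** (M - Q ** transpose M ** Q) = transpose Q ** M - transpose M ** Q"
    by (simp add: matrix_mult.diff_right matrix_mul_assoc 1)
  then show ?thesis by (simp add: transpose_diff matrix_transpose_mul)
qed

text \<open>Block \<open>i\<close> of the retraction is
  \<open>Q ** matrix_exp (t *\<^sub>R \<Omega>)\<close> with \<open>\<Omega>\<close> skew and no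
  longer than the gradient. Left multiplication by \<open>Q\<close> is an isometry, so the bounds
  are those of the exponential, with constants independent of \<open>S\<close>.\<close>

lemma retract_grad_block:
  fixes S :: "('m::finite, 'd::finite) stack"
    and C :: "real ^ ('m \<times> 'd) ^ ('m \<times> 'd)"
  assumes "S \<in> alignments" "0 \<le> t"
  defines "G \<equiv> grad_objective C S" and "c \<equiv> norm (mat 1 :: real ^ 'd ^ 'd)"
  shows "orthogonal_matrix (block (retract S (- t *\<^sub>R G)) i)"
    and "norm (block (retract S (- t *\<^sub>R G) - S) i) \<le> c * (t * norm G)"
    and "norm (block (retract S (- t *\<^sub>R G) - S + t *\<^sub>R G) i) \<le> c * (t * norm G)\<^sup>2"
proof -
  define Q where "Q = block S i"
  define \<Omega> where "\<Omega> = - (transpose Q ** block G i)"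
  have Q: "orthogonal_matrix Q" using assms(1) by (simp add: alignments_def Q_def)
  have skew: "transpose \<Omega> = - \<Omega>"
    using transpose_mult_grad_skew[OF Q, of "block (C ** S) i"]
    by (simp add: \<Omega>_def G_def transpose_minus flip: Q_def)
  have "norm \<Omega> = norm (block G i)"
    using Q by (simp add: \<Omega>_def norm_mult_orthogonal orthogonal_matrix_transpose)
  then have norm_\<Omega>: "t * norm \<Omega> \<le> t * norm G"
    using norm_block_le[of G i] \<open>0 \<le> t\<close> by (simp add: mult_left_mono)
  define Y where "Y = matrix_exp (t *\<^sub>R \<Omega>)"
  have arg: "transpose Q ** block (- t *\<^sub>R G) i = t *\<^sub>R \<Omega>"
    by (simp add: \<Omega>_def matrix_mult_scaleR matrix_mult.minus_right)
  have R: "block (retract S (- t *\<^sub>R G)) i = Q ** Y"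
    by (simp only: block_retract Y_def arg flip: Q_def)
  have "orthogonal_matrix Y"
    unfolding Y_def using skew by (intro orthogonal_matrix_exp) (simp add: transpose_scalar)
  then show "orthogonal_matrix (block (retract S (- t *\<^sub>R G)) i)"
    unfolding R by (rule orthogonal_matrix_mul[OF Q])
  have "block (retract S (- t *\<^sub>R G) - S) i = Q ** (Y - mat 1)"
    by (simp only: block_diff R matrix_mult.diff_right matrix_mul_rid flip: Q_def)
  then have "norm (block (retract S (- t *\<^sub>R G) - S) i) = norm (Y - mat 1)"
    using Q by (simp add: norm_mult_orthogonal)
  also have "\<dots> \<le> t * norm \<Omega> * c"
    unfolding Y_def c_def using norm_matrix_exp_minus_id[OF skew \<open>0 \<le> t\<close>] .
  also have "\<dots> \<le> t * norm G * c"
    by (intro mult_right_mono norm_\<Omega>) (simp add: c_def)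
  finally show "norm (block (retract S (- t *\<^sub>R G) - S) i) \<le> c * (t * norm G)"
    by (simp add: mult.commute)
  have "Q ** \<Omega> = - block G i"
    using Q by (simp add: \<Omega>_def matrix_mult.minus_right matrix_mul_assoc orthogonal_matrix_def)
  then have "block (retract S (- t *\<^sub>R G) - S + t *\<^sub>R G) i = Q ** (Y - mat 1 - t *\<^sub>R \<Omega>)"
    by (simp only: block_add block_diff block_scaleR R matrix_mult.diff_right matrix_mult_scaleR
        matrix_mul_rid flip: Q_def) simp
  then have "norm (block (retract S (- t *\<^sub>R G) - S + t *\<^sub>R G) i) = norm (Y - mat 1 - t *\<^sub>R \<Omega>)"
    using Q by (simp add: norm_mult_orthogonal)
  also have "\<dots> \<le> (t * norm \<Omega>)\<^sup>2 * c"
    unfolding Y_def c_def using norm_matrix_exp_taylor[OF skew \<open>0 \<le> t\<close>] .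
  also have "\<dots> \<le> (t * norm G)\<^sup>2 * c"
    using \<open>0 \<le> t\<close> by (intro mult_right_mono power_mono norm_\<Omega>) (simp_all add: c_def)
  finally show "norm (block (retract S (- t *\<^sub>R G) - S + t *\<^sub>R G) i) \<le> c * (t * norm G)\<^sup>2"
    by (simp add: mult.commute)
qed

text \<open>The increment \<open>D\<close> is \<open>- t G\<close> up to second order. Of the factor
  3, two parts come from the linear term of the expansion paired with \<open>D + t G\<close>, and
  one from the quadratic term in \<open>D\<close>.\<close>

lemma objective_retract_le:
  fixes S :: "('m::finite, 'd::finite) stack"
    and C :: "real ^ ('m \<times> 'd) ^ ('m \<times> 'd)"
  assumes "transpose C = C" "S \<in> alignments" "0 \<le> t"
  defines "G \<equiv> grad_objective C S" and "c \<equiv> real CARD('m) * norm (mat 1 :: real ^ 'd ^ 'd)"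
  shows "objective C (retract S (- t *\<^sub>R G)) - objective C S
    \<le> - t * (norm G)\<^sup>2 + 3 * norm C * c\<^sup>2 * (t * norm G)\<^sup>2"
proof -
  define D where "D = retract S (- t *\<^sub>R G) - S"
  note blk = retract_grad_block[OF assms(2,3), of C, folded G_def]
  have D: "norm D \<le> c * (t * norm G)" "norm (D + t *\<^sub>R G) \<le> c * (t * norm G)\<^sup>2"
    unfolding D_def c_def mult.assoc using blk(2,3) by (intro norm_stack_le; simp)+
  have "norm S \<le> c"
    unfolding c_def using assms(2)
    by (intro norm_stack_le) (simp add: alignments_def norm_orthogonal_matrix)
  have "0 \<le> c" by (simp add: c_def)
  have "(C ** S) \<bullet> (D + t *\<^sub>R G) \<le> norm (C ** S) * norm (D + t *\<^sub>R G)"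
    by (rule norm_cauchy_schwarz)
  also have "\<dots> \<le> (norm C * c) * (c * (t * norm G)\<^sup>2)"
    using order_trans[OF norm_matrix_mult_le[of C S] mult_left_mono[OF \<open>norm S \<le> c\<close>, of "norm C"]]
      \<open>0 \<le> c\<close> D(2)
    by (intro mult_mono) simp_all
  finally have 1: "(C ** S) \<bullet> (D + t *\<^sub>R G) \<le> norm C * c\<^sup>2 * (t * norm G)\<^sup>2"
    by (simp add: power2_eq_square mult_ac)
  have "D \<bullet> (C ** D) \<le> norm D * norm (C ** D)"
    by (rule norm_cauchy_schwarz)
  also have "\<dots> \<le> norm D * (norm C * norm D)"
    by (intro mult_left_mono norm_matrix_mult_le) simp
  also have "\<dots> = norm C * (norm D)\<^sup>2"
    by (simp add: power2_eq_square)
  also have "\<dots> \<le> norm C * (c * (t * norm G))\<^sup>2"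
    using D(1) by (intro mult_left_mono power_mono) auto
  finally have 2: "D \<bullet> (C ** D) \<le> norm C * c\<^sup>2 * (t * norm G)\<^sup>2"
    by (simp add: power_mult_distrib mult_ac)
  have "objective C (S + D) - objective C S = 2 * ((C ** S) \<bullet> D) + D \<bullet> (C ** D)"
    by (simp add: objective_add[OF assms(1)])
  also have "2 * ((C ** S) \<bullet> D) = 2 * ((C ** S) \<bullet> (D + t *\<^sub>R G)) - t * (norm G)\<^sup>2"
    unfolding G_def inner_grad_objective[OF assms(2), symmetric]
    by (simp add: inner_add_right algebra_simps)
  finally show ?thesis
    using 1 2 by (simp add: D_def)
qed

text \<open>Powers of \<open>\<beta>\<close> decrease, so the greatest admissible one has the least
  admissible exponent. Thus any single admissible \<open>l\<close> bounds the step size from below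
  by \<open>\<beta> ^ l\<close>.\<close>

lemma Greatest_powers:
  fixes \<beta> :: real
  assumes "0 < \<beta>" "\<beta> < 1" "P l"
  defines "a \<equiv> (GREATEST a. a \<in> {\<beta> ^ l | l. P l})"
  shows "\<exists>l'\<le>l. P l' \<and> a = \<beta> ^ l'"
proof -
  define l' where "l' = (LEAST l. P l)"
  have l': "P l'" "\<And>k. P k \<Longrightarrow> l' \<le> k"
    unfolding l'_def using \<open>P l\<close> by (auto intro: LeastI Least_le)
  have "a = \<beta> ^ l'"
    unfolding a_def
  proof (rule Greatest_equality)
    show "y \<le> \<beta> ^ l'" if "y \<in> {\<beta> ^ l | l. P l}" for y
      using that l'(2) assms(1,2) by (auto intro!: power_decreasing)
  qed (use l' in blast)
  then show ?thesis using l' \<open>P l\<close> by blast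
qed

text \<open>The bound \<open>- t + K t^2 \<le> - \<gamma> t\<close> amounts to
  \<open>K t \<le> 1 - \<gamma>\<close> for \<open>t > 0\<close>, which is the hypothesis on
  \<open>l\<close> at \<open>t = \<beta> ^ l\<close>. As \<open>K\<close> does not involve
  \<open>S\<close>, one \<open>l\<close> serves all iterates.\<close>

lemma step_size_props:
  fixes S :: "('m::finite, 'd::finite) stack"
    and C :: "real ^ ('m \<times> 'd) ^ ('m \<times> 'd)"
  assumes "transpose C = C" "S \<in> alignments" "0 < \<beta>" "\<beta> < 1"
    and l: "3 * norm C * (real CARD('m) * norm (mat 1 :: real ^ 'd ^ 'd))\<^sup>2 * \<beta> ^ l \<le> 1 - \<gamma>"
  defines "G \<equiv> grad_objective C S" and "a \<equiv> step_size C \<beta> \<gamma> S"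
  shows "\<beta> ^ l \<le> a" "a \<le> 1"
    "objective C (retract S (- a *\<^sub>R G)) - objective C S \<le> - \<gamma> * a * (norm G)\<^sup>2"
proof -
  define P where "P l \<longleftrightarrow> objective C (retract S (- (\<beta> ^ l) *\<^sub>R G)) - objective C S
      \<le> - \<gamma> * \<beta> ^ l * (norm G)\<^sup>2" for l
  have "trace (transpose (nabla_objective C S) ** grad_objective C S) = (norm G)\<^sup>2"
    unfolding G_def inner_grad_objective[OF assms(2), symmetric]
    by (simp add: nabla_objective_def trace_transpose_mult)
  then have steps: "armijo_steps C \<beta> \<gamma> S = {\<beta> ^ l | l. P l}"
    by (simp add: armijo_steps_def P_def G_def)
  have "P l"
  proof -
    let ?K = "3 * norm C * (real CARD('m) * norm (mat 1 :: real ^ 'd ^ 'd))\<^sup>2"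
    have "objective C (retract S (- (\<beta> ^ l) *\<^sub>R G)) - objective C S
        \<le> - (\<beta> ^ l) * (norm G)\<^sup>2 + ?K * (\<beta> ^ l * norm G)\<^sup>2"
      unfolding G_def using assms(3) by (intro objective_retract_le assms(1,2)) simp
    also have "?K * (\<beta> ^ l * norm G)\<^sup>2 = (?K * \<beta> ^ l) * (\<beta> ^ l * (norm G)\<^sup>2)"
      by (simp add: power2_eq_square mult_ac)
    also have "\<dots> \<le> (1 - \<gamma>) * (\<beta> ^ l * (norm G)\<^sup>2)"
      using l assms(3) by (intro mult_right_mono) auto
    finally show ?thesis by (simp add: P_def algebra_simps)
  qed
  then obtain l' where l': "l' \<le> l" "P l'" "a = \<beta> ^ l'"
    using Greatest_powers[of \<beta> P l] assms(3,4) unfolding a_def step_size_def steps by blast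
  show "\<beta> ^ l \<le> a" "a \<le> 1"
    using l' assms(3,4) by (auto intro!: power_decreasing power_le_one)
  show "objective C (retract S (- a *\<^sub>R G)) - objective C S \<le> - \<gamma> * a * (norm G)\<^sup>2"
    using l' by (simp add: P_def)
qed

subsection \<open>The iteration on the reduced alignments\<close>

lemma block_reduce:
  "block (reduce S) i =
     (if i = first_view then 0 else block S i ** transpose (block S first_view))"
  by (simp add: reduce_def)

lemma block_prepend_id:
  "block (prepend_id X) i = (if i = first_view then mat 1 else block X i)"
  by (simp add: prepend_id_def)

lemma prepend_id_in_alignments: "X \<in> reduced_alignments \<Longrightarrow> prepend_id X \<in> alignments"
  by (simp add: reduced_alignments_def alignments_def block_prepend_id orthogonal_matrix_id)

lemma reduce_in_reduced_alignments: "S \<in> alignments \<Longrightarrow> reduce S \<in> reduced_alignments"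
  by (simp add: reduced_alignments_def alignments_def block_reduce orthogonal_matrix_mul)

lemma reduced_objective_eq: "reduced_objective C X = objective C (prepend_id X)"
  by (simp add: reduced_objective_def objective_def)

text \<open>\<open>prepend_id (reduce S)\<close> is \<open>S\<close> times the transpose of its
  first block, another representative of the same class.\<close>

lemma reduced_objective_reduce:
  assumes "S \<in> alignments"
  shows "reduced_objective C (reduce S) = objective C S"
proof -
  have orth: "orthogonal_matrix (block S first_view)"
    using assms by (simp add: alignments_def)
  then have "prepend_id (reduce S) = S ** transpose (block S first_view)"
    by (intro stack_eqI) (simp add: block_prepend_id block_reduce orthogonal_matrix_def)
  then show ?thesis
    using orth by (simp add: reduced_objective_eq objective_mult_orthogonal)
qed

text \<open>Up to the isometry \<open>transpose Q\<close>, where \<open>Q\<close> is the first block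
  of \<open>S\<close>, block \<open>i\<close> of the difference is \<open>S_i - X_i Q\<close>. This
  is the displacement of block \<open>i\<close> minus \<open>X_i\<close> times that of the first
  block, whence the factor 2.\<close>

lemma norm_reduce_diff_le:
  fixes X :: "('m::{finite, linorder}, 'd::finite) stack"
  assumes "X \<in> reduced_alignments" "S \<in> alignments"
  shows "norm (reduce S - X) \<le> 2 * real CARD('m) * norm (S - prepend_id X)"
proof -
  define D where "D = S - prepend_id X"
  have "norm (block (reduce S - X) i) \<le> 2 * norm D" for i
  proof (cases "i = first_view")
    case True
    then show ?thesis using assms(1) by (simp add: block_reduce reduced_alignments_def)
  next
    case False
    define Q where "Q = block S first_view"
    have Q: "orthogonal_matrix Q" using assms(2) by (simp add: alignments_def Q_def)
    have X: "orthogonal_matrix (block X i)"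
      using assms(1) False by (simp add: reduced_alignments_def)
    have D: "block D i = block S i - block X i" "block D first_view = Q - mat 1"
      using False by (simp_all add: D_def Q_def block_prepend_id)
    have "block X i = block X i ** (Q ** transpose Q)"
      using Q by (simp add: orthogonal_matrix_def)
    then have "block (reduce S - X) i = (block S i - block X i ** Q) ** transpose Q"
      using False by (simp add: block_reduce matrix_mult.diff_left matrix_mul_assoc flip: Q_def)
    then have "norm (block (reduce S - X) i) = norm (block D i - block X i ** block D first_view)"
      using Q by (simp add: norm_mult_orthogonal D matrix_mult.diff_right)
    also have "\<dots> \<le> norm (block D i) + norm (block D first_view)"
      using norm_triangle_ineq4 norm_mult_orthogonal(1)[OF X] by metis
    also have "\<dots> \<le> 2 * norm D"
      using norm_block_le[of D i] norm_block_le[of D first_view] by simp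
    finally show ?thesis .
  qed
  from norm_stack_le[OF this] show ?thesis by (simp add: D_def)
qed

text \<open>The decrease uses the lower bound \<open>\<beta> ^ l\<close> on the step size, the bound
  on the movement its upper bound 1.\<close>

lemma rgd_step_props:
  fixes X :: "('m::{finite, linorder}, 'd::finite) stack"
    and C :: "real ^ ('m \<times> 'd) ^ ('m \<times> 'd)"
  assumes "transpose C = C" "X \<in> reduced_alignments" "0 < \<beta>" "\<beta> < 1" "0 < \<gamma>"
    and l: "3 * norm C * (real CARD('m) * norm (mat 1 :: real ^ 'd ^ 'd))\<^sup>2 * \<beta> ^ l \<le> 1 - \<gamma>"
  defines "G \<equiv> grad_objective C (prepend_id X)" and "c \<equiv> real CARD('m) * norm (mat 1 :: real ^ 'd ^ 'd)"
  shows "rgd_step C \<beta> \<gamma> X \<in> reduced_alignments"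
    and "\<gamma> * \<beta> ^ l * (norm G)\<^sup>2 \<le> reduced_objective C X - reduced_objective C (rgd_step C \<beta> \<gamma> X)"
    and "norm (rgd_step C \<beta> \<gamma> X - X) \<le> 2 * real CARD('m) * c * norm G"
proof -
  define S where "S = prepend_id X"
  define a where "a = step_size C \<beta> \<gamma> S"
  define T where "T = retract S (- a *\<^sub>R G)"
  have S: "S \<in> alignments" using assms(2) by (simp add: S_def prepend_id_in_alignments)
  have G: "G = grad_objective C S" by (simp add: G_def S_def)
  have a: "\<beta> ^ l \<le> a" "a \<le> 1" "objective C T - objective C S \<le> - \<gamma> * a * (norm G)\<^sup>2"
    using step_size_props[OF assms(1) S assms(3,4) l] by (simp_all add: a_def T_def G)
  have "0 \<le> a" using a(1) assms(3) by (meson less_imp_le order_trans zero_less_power)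
  note blk = retract_grad_block[OF S \<open>0 \<le> a\<close>, of C, folded G, folded T_def]
  have T: "T \<in> alignments" unfolding alignments_def using blk(1) by blast
  have step: "rgd_step C \<beta> \<gamma> X = reduce T"
    by (simp add: rgd_step_def Let_def T_def a_def G flip: S_def)
  show "rgd_step C \<beta> \<gamma> X \<in> reduced_alignments"
    unfolding step by (rule reduce_in_reduced_alignments[OF T])
  have "\<gamma> * \<beta> ^ l * (norm G)\<^sup>2 \<le> \<gamma> * a * (norm G)\<^sup>2"
    using a(1) assms(5) by (intro mult_right_mono mult_left_mono) auto
  then show "\<gamma> * \<beta> ^ l * (norm G)\<^sup>2 \<le> reduced_objective C X - reduced_objective C (rgd_step C \<beta> \<gamma> X)"
    using a(3) unfolding step reduced_objective_reduce[OF T] reduced_objective_eq[of C X] S_def[symmetric]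
    by simp
  have "norm (T - S) \<le> c * (a * norm G)"
    unfolding c_def mult.assoc by (intro norm_stack_le blk(2))
  also have "\<dots> \<le> c * norm G"
    using a(2) by (intro mult_left_mono mult_left_le_one_le \<open>0 \<le> a\<close>) (simp_all add: c_def)
  finally have "2 * real CARD('m) * norm (T - S) \<le> 2 * real CARD('m) * (c * norm G)"
    by (intro mult_left_mono) simp_all
  then show "norm (rgd_step C \<beta> \<gamma> X - X) \<le> 2 * real CARD('m) * c * norm G"
    using norm_reduce_diff_le[OF assms(2) T] unfolding step S_def mult.assoc by linarith
qed

subsection \<open>The reduced gradient and an error bound near nondegenerate critical points\<close>

text \<open>The orthogonal projection onto the linear subspace that encodes the reduced matrices; it
  is also the linear part of the affine map \<open>prepend_id\<close>.\<close>

definition drop_first :: "('m::{finite, linorder}, 'd::finite) stack \<Rightarrow> ('m, 'd) stack" where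
  "drop_first Z = stack (\<lambda>i. if i = first_view then 0 else block Z i)"

lemma block_drop_first: "block (drop_first Z) i = (if i = first_view then 0 else block Z i)"
  by (simp add: drop_first_def)

lemma bounded_linear_drop_first: "bounded_linear drop_first"
  by (intro linear_conv_bounded_linear[THEN iffD1] linearI; rule stack_eqI)
    (simp_all add: block_drop_first)

lemma inner_drop_first: "drop_first A \<bullet> B = A \<bullet> drop_first B"
  unfolding inner_block by (intro sum.cong) (simp_all add: block_drop_first)

lemma norm_drop_first_le: "norm (drop_first A) \<le> norm A"
proof (cases "drop_first A = 0")
  case False
  have "drop_first (drop_first A) = drop_first A"
    by (rule stack_eqI) (simp add: block_drop_first)
  then have "norm (drop_first A) * norm (drop_first A) = A \<bullet> drop_first A"
    by (metis inner_drop_first power2_eq_square power2_norm_eq_inner)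
  also have "\<dots> \<le> norm A * norm (drop_first A)"
    by (rule norm_cauchy_schwarz)
  finally show ?thesis using False by simp
qed simp

lemma prepend_id_eq: "prepend_id X = prepend_id 0 + drop_first X"
  by (rule stack_eqI) (simp add: block_prepend_id block_drop_first)

lemma has_derivative_prepend_id: "(prepend_id has_derivative drop_first) (at X)"
proof -
  have "((\<lambda>X. prepend_id 0 + drop_first X) has_derivative (\<lambda>h. 0 + drop_first h)) (at X)"
    by (intro has_derivative_add has_derivative_const
        bounded_linear.has_derivative[OF bounded_linear_drop_first] has_derivative_ident)
  then show ?thesis by (simp flip: prepend_id_eq)
qed

lemma GDERIV_reduced_objective:
  assumes "transpose C = C"
  shows "GDERIV (reduced_objective C) X :> drop_first (2 *\<^sub>R (C ** prepend_id X))"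
  unfolding gderiv_def
proof -
  have "((\<lambda>X. prepend_id X \<bullet> (C ** prepend_id X)) has_derivative
      (\<lambda>h. prepend_id X \<bullet> (C ** drop_first h) + drop_first h \<bullet> (C ** prepend_id X))) (at X)"
    by (intro has_derivative_inner has_derivative_prepend_id
        bounded_linear.has_derivative[OF matrix_mult.bounded_linear_right])
  moreover have "prepend_id X \<bullet> (C ** drop_first h) + drop_first h \<bullet> (C ** prepend_id X) =
      h \<bullet> drop_first (2 *\<^sub>R (C ** prepend_id X))" for h
  proof -
    have "prepend_id X \<bullet> (C ** drop_first h) = drop_first h \<bullet> (C ** prepend_id X)"
      by (metis assms inner_commute inner_matrix_mult_left)
    then show ?thesis by (simp flip: inner_drop_first)
  qed
  ultimately show "(reduced_objective C has_derivative (\<lambda>h. h \<bullet> drop_first (2 *\<^sub>R (C ** prepend_id X)))) (at X)"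
    by (simp add: reduced_objective_eq[abs_def] objective_eq_inner)
qed

lemma euclidean_grad_eqI:
  assumes "GDERIV f p :> g"
  shows "euclidean_grad f p = g"
  unfolding euclidean_grad_def
proof (rule the_equality)
  fix g' assume "GDERIV f p :> g'"
  then have "(\<lambda>h. h \<bullet> g') = (\<lambda>h. h \<bullet> g)"
    using assms unfolding gderiv_def by (rule has_derivative_unique)
  then have "(g' - g) \<bullet> g' = (g' - g) \<bullet> g" by (rule fun_cong)
  then have "(g' - g) \<bullet> (g' - g) = 0" by (simp add: inner_diff_right)
  then show "g' = g" by simp
qed fact

lemma block_reduced_proj:
  "block (reduced_proj X Z) i = (if i = first_view then 0
     else (1 / 2) *\<^sub>R (block Z i - block X i ** transpose (block Z i) ** block X i))"
  by (simp add: reduced_proj_def)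

text \<open>Tangent projections act block by block, so freezing the first block merely deletes that
  block of the gradient. The identity holds at every \<open>X\<close>, not only on the reduced
  alignments, and can therefore be differentiated in the ambient space.\<close>

lemma reduced_grad_reduced_objective:
  assumes "transpose C = C"
  shows "reduced_grad (reduced_objective C) X = drop_first (grad_objective C (prepend_id X))"
  unfolding reduced_grad_def euclidean_grad_eqI[OF GDERIV_reduced_objective[OF assms]]
  by (rule stack_eqI)
    (simp add: block_reduced_proj block_drop_first block_prepend_id transpose_scalar
      matrix_mult_scaleR scaleR_diff_right)

lemma differentiable_grad_objective: "grad_objective C differentiable (at S)"
proof -
  have blk: "(\<lambda>S. block S i) differentiable (at S)" for i
    by (rule bounded_linear_imp_differentiable[OF bounded_linear_block])
  have "(\<lambda>S. block (C ** S) i) differentiable (at S)" for i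
    by (rule bounded_linear_imp_differentiable[OF
          bounded_linear_compose[OF bounded_linear_block matrix_mult.bounded_linear_right]])
  moreover have "(\<lambda>S. transpose (block (C ** S) i)) differentiable (at S)" for i
    by (rule bounded_linear_imp_differentiable[OF bounded_linear_compose[OF bounded_linear_transpose
          bounded_linear_compose[OF bounded_linear_block matrix_mult.bounded_linear_right]]])
  ultimately show ?thesis
    unfolding grad_objective_def[abs_def]
    by (intro differentiable_stack differentiable_diff differentiable_matrix_mult blk)
qed

lemma differentiable_reduced_grad:
  assumes "transpose C = C"
  shows "reduced_grad (reduced_objective C) differentiable (at X)"
proof -
  have "grad_objective C \<circ> prepend_id differentiable (at X)"
    using has_derivative_prepend_id differentiable_grad_objective
    by (intro differentiable_chain_at) (auto simp: differentiable_def)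
  moreover have "drop_first differentiable (at Y)" for Y :: "('m::{finite, linorder}, 'd::finite) stack"
    by (rule bounded_linear_imp_differentiable[OF bounded_linear_drop_first])
  ultimately have "drop_first \<circ> (grad_objective C \<circ> prepend_id) differentiable (at X)"
    by (rule differentiable_chain_at)
  then show ?thesis
    by (simp add: reduced_grad_reduced_objective[OF assms, abs_def] o_def)
qed

lemma bounded_linear_reduced_proj: "bounded_linear (reduced_proj X)"
  by (intro linear_conv_bounded_linear[THEN iffD1] linearI; rule stack_eqI)
    (simp_all add: block_reduced_proj transpose_add transpose_scalar matrix_mult_scaleR
      matrix_add_ldistrib matrix_mult.add_left algebra_simps)

text \<open>With \<open>X = Q + D\<close> blockwise, \<open>D + Q D\<^sup>T Q = - Q D\<^sup>T D\<close>: the chord from \<open>Q\<close> to \<open>X\<close> is tangent up to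
  second order.\<close>

lemma norm_normal_part_le:
  fixes X P :: "('m::{finite, linorder}, 'd::finite) stack"
  assumes "X \<in> reduced_alignments" "P \<in> reduced_alignments"
  shows "norm ((X - P) - reduced_proj P (X - P)) \<le> real CARD('m) * (norm (X - P))\<^sup>2"
proof (rule norm_stack_le)
  fix i
  show "norm (block ((X - P) - reduced_proj P (X - P)) i) \<le> (norm (X - P))\<^sup>2"
  proof (cases "i = first_view")
    case True
    then show ?thesis
      using assms by (simp add: block_reduced_proj reduced_alignments_def)
  next
    case False
    define Q where "Q = block P i"
    define D where "D = block (X - P) i"
    have Q: "orthogonal_matrix Q" and "orthogonal_matrix (Q + D)"
      using assms False by (simp_all add: reduced_alignments_def Q_def D_def)
    then have 1: "transpose Q ** Q = mat 1" "Q ** transpose Q = mat 1" and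
      2: "transpose (Q + D) ** (Q + D) = mat 1"
      by (simp_all add: orthogonal_matrix_def)
    have "transpose (Q + D) ** (Q + D) =
        transpose Q ** Q + (transpose Q ** D + (transpose D ** Q + transpose D ** D))"
      by (simp add: transpose_add matrix_mult.add_left matrix_add_ldistrib)
    then have "transpose Q ** D + (transpose D ** Q + transpose D ** D) = 0"
      using 1 2 by simp
    then have "Q ** (transpose Q ** D + (transpose D ** Q + transpose D ** D)) = 0"
      by simp
    then have "D + Q ** transpose D ** Q = - (Q ** (transpose D ** D))"
      by (simp add: matrix_add_ldistrib matrix_mul_assoc 1 eq_neg_iff_add_eq_0 add.assoc)
    moreover have "block ((X - P) - reduced_proj P (X - P)) i = (1 / 2) *\<^sub>R (D + Q ** transpose D ** Q)"
    proof -
      have "D = (1 / 2) *\<^sub>R D + (1 / 2) *\<^sub>R D"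
        by (simp flip: scaleR_add_left)
      then show ?thesis
        using False unfolding block_diff[of "X - P"] block_reduced_proj D_def[symmetric] Q_def[symmetric]
        by (simp add: scaleR_diff_right scaleR_add_right)
    qed
    ultimately have "norm (block ((X - P) - reduced_proj P (X - P)) i) = norm (transpose D ** D) / 2"
      using Q by (simp add: norm_mult_orthogonal)
    also have "\<dots> \<le> norm D * norm D"
      using norm_matrix_mult_le[of "transpose D" D] mult_nonneg_nonneg[OF norm_ge_zero norm_ge_zero, of D D]
      unfolding norm_transpose by linarith
    also have "\<dots> \<le> norm (X - P) * norm (X - P)"
      unfolding D_def by (intro mult_mono norm_block_le) simp_all
    finally show ?thesis by (simp add: power2_eq_square)
  qed
qed

text \<open>Non-singularity controls the derivative of the gradient on tangent vectors only.
  Recording the normal part of \<open>W\<close> beside the projected derivative gives a map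
  \<open>N\<close> injective on the whole space, hence bounded below in finite dimension; for a
  chord the normal part is of second order and is absorbed.\<close>

lemma reduced_grad_lower_bound:
  fixes P :: "('m::{finite, linorder}, 'd::finite) stack"
  assumes P: "P \<in> reduced_alignments" and crit: "reduced_grad f P = 0"
    and diff: "reduced_grad f differentiable (at P)" and hess: "hess_nonsingular f P"
  shows "\<exists>c>0. \<exists>r>0. \<forall>X\<in>reduced_alignments. norm (X - P) < r \<longrightarrow> c * norm (X - P) \<le> norm (reduced_grad f X)"
proof -
  define H where "H = reduced_grad f"
  define H' where "H' = frechet_derivative H (at P)"
  define \<pi> where "\<pi> = reduced_proj P"
  have \<pi>: "bounded_linear \<pi>" unfolding \<pi>_def by (rule bounded_linear_reduced_proj)
  have H': "(H has_derivative H') (at P)"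
    using diff unfolding H'_def H_def by (simp add: frechet_derivative_works)
  define N where "N W = (\<pi> (H' W), W - \<pi> W)" for W
  have "bounded_linear N"
    unfolding N_def[abs_def]
    by (intro bounded_linear_Pair bounded_linear_compose[OF \<pi> has_derivative_bounded_linear[OF H']]
        bounded_linear_sub bounded_linear_ident \<pi>)
  then have lin: "linear N" by (rule bounded_linear.linear)
  \<comment> \<open>The second component of \<open>N\<close> vanishes on tangent vectors only, where the first one is the Hessian.\<close>
  have "inj N"
    unfolding linear_injective_0[OF lin]
  proof (intro allI impI)
    fix W assume "N W = 0"
    then have "\<pi> (H' W) = 0" "W = \<pi> W" by (simp_all add: N_def zero_prod_def)
    moreover from this have "W \<in> reduced_tangent P"
      using reduced_proj_in_tangent[OF P, of W] by (simp add: \<pi>_def)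
    ultimately show "W = 0"
      using hess by (simp add: hess_nonsingular_def reduced_hess_def \<pi>_def H'_def H_def)
  qed
  then obtain B where B: "0 < B" "\<And>W. B * norm W \<le> norm (N W)"
    using linear_inj_bounded_below_pos[OF lin] by blast
  obtain K where K: "0 < K" "\<And>Y. norm (\<pi> Y) \<le> norm Y * K"
    using bounded_linear.pos_bounded[OF \<pi>] by blast
  \<comment> \<open>After projection, which costs the factor \<open>K\<close>, the linearisation
    error is at most \<open>B / 4\<close> times \<open>norm W\<close>.\<close>
  define \<epsilon> where "\<epsilon> = B / (4 * K)"
  have "0 < \<epsilon>" using B K by (simp add: \<epsilon>_def)
  then obtain r where r: "0 < r" "\<And>X. norm (X - P) < r \<Longrightarrow> norm (H X - H P - H' (X - P)) \<le> \<epsilon> * norm (X - P)"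
    using H' unfolding has_derivative_at_alt by blast
  \<comment> \<open>The second bound limits the normal part of the chord to another
    \<open>B / 4\<close> times \<open>norm W\<close>, so half of \<open>B\<close> survives.\<close>
  define r' where "r' = min r (B / (4 * real CARD('m)))"
  have "0 < r'" using r B by (simp add: r'_def)
  have "B / (2 * K) * norm (X - P) \<le> norm (H X)" if X: "X \<in> reduced_alignments" "norm (X - P) < r'" for X
  proof -
    define W where "W = X - P"
    define R where "R = H X - H P - H' W"
    have small: "norm W < r" "norm W \<le> B / (4 * real CARD('m))" using X by (simp_all add: r'_def W_def)
    have R: "norm R \<le> \<epsilon> * norm W" unfolding R_def W_def using r(2) small by (simp add: W_def)
    have "H' W = H X - R" using crit by (simp add: R_def H_def)
    then have "\<pi> (H' W) = \<pi> (H X) - \<pi> R" by (simp add: linear_diff[OF bounded_linear.linear[OF \<pi>]])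
    then have "norm (\<pi> (H' W)) \<le> norm (\<pi> (H X)) + norm (\<pi> R)" by (simp add: norm_triangle_ineq4)
    also have "\<dots> \<le> norm (H X) * K + (\<epsilon> * norm W) * K"
      using K R by (intro add_mono order_trans[OF K(2)] mult_right_mono) auto
    also have "\<epsilon> * norm W * K = B / 4 * norm W" using K by (simp add: \<epsilon>_def)
    finally have 1: "norm (\<pi> (H' W)) \<le> norm (H X) * K + B / 4 * norm W" .
    have "norm (W - \<pi> W) \<le> real CARD('m) * norm W * norm W"
      using norm_normal_part_le[OF X(1) P] by (simp add: W_def \<pi>_def power2_eq_square mult_ac)
    also have "\<dots> \<le> B / 4 * norm W"
      using small(2) by (intro mult_right_mono) (simp_all add: field_simps)
    finally have 2: "norm (W - \<pi> W) \<le> B / 4 * norm W" .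
    have "B * norm W \<le> norm (\<pi> (H' W)) + norm (W - \<pi> W)"
      using B(2)[of W] norm_Pair_le[of "\<pi> (H' W)" "W - \<pi> W"] by (simp add: N_def)
    then have "B / 2 * norm W \<le> norm (H X) * K" using 1 2 by simp
    then show ?thesis using K by (simp add: W_def field_simps)
  qed
  moreover have "0 < B / (2 * K)" using B K by simp
  ultimately show ?thesis using \<open>0 < r'\<close> unfolding H_def by blast
qed

text \<open>Criticality says that the ambient gradient \<open>g\<close> is normal at
  \<open>P\<close>, so it sees only the normal part of the chord, which is quadratic. The remaining
  term of the exact expansion is quadratic as well, so the bound is global.\<close>

lemma reduced_objective_quadratic_bound:
  fixes P :: "('m::{finite, linorder}, 'd::finite) stack"
    and C :: "real ^ ('m \<times> 'd) ^ ('m \<times> 'd)"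
  assumes C: "transpose C = C" and P: "P \<in> reduced_alignments"
    and crit: "reduced_grad (reduced_objective C) P = 0"
  shows "\<exists>K\<ge>0. \<forall>X\<in>reduced_alignments. reduced_objective C X - reduced_objective C P \<le> K * (norm (X - P))\<^sup>2"
proof -
  define g where "g = drop_first (2 *\<^sub>R (C ** prepend_id P))"
  have proj_g: "reduced_proj P g = 0"
    using crit unfolding reduced_grad_def euclidean_grad_eqI[OF GDERIV_reduced_objective[OF C]] g_def .
  define K where "K = norm g * real CARD('m) + norm C"
  have "reduced_objective C X - reduced_objective C P \<le> K * (norm (X - P))\<^sup>2"
    if X: "X \<in> reduced_alignments" for X
  proof -
    define W where "W = X - P"
    let ?N = "W - reduced_proj P W"
    have W: "drop_first W = W"
      using X P by (intro stack_eqI) (auto simp: block_drop_first W_def reduced_alignments_def)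
    have "prepend_id X = prepend_id P + W"
      using X P by (intro stack_eqI) (auto simp: block_prepend_id W_def reduced_alignments_def)
    then have "reduced_objective C X - reduced_objective C P
        = 2 * ((C ** prepend_id P) \<bullet> W) + W \<bullet> (C ** W)"
      by (simp add: reduced_objective_eq objective_add[OF C])
    also have "2 * ((C ** prepend_id P) \<bullet> W) = g \<bullet> W"
      by (simp add: g_def inner_drop_first W)
    also have "g \<bullet> W = g \<bullet> ?N"
      using reduced_proj_orthogonal[OF P reduced_proj_in_tangent[OF P], of g W] proj_g
      by (simp add: inner_diff_right)
    also have "\<dots> \<le> norm g * (real CARD('m) * (norm W)\<^sup>2)"
      using norm_normal_part_le[OF X P] unfolding W_def
      by (intro order_trans[OF norm_cauchy_schwarz] mult_left_mono) simp_all
    also have "W \<bullet> (C ** W) \<le> norm W * (norm C * norm W)"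
      by (intro order_trans[OF norm_cauchy_schwarz] mult_left_mono norm_matrix_mult_le) simp
    finally show ?thesis
      by (simp add: K_def W_def algebra_simps power2_eq_square)
  qed
  moreover have "0 \<le> K" by (simp add: K_def)
  ultimately show ?thesis by blast
qed

subsection \<open>Linear convergence\<close>

theorem theorem5p1:
  fixes E :: "('n::finite \<times> 'm::{finite, linorder}) set"
    and x :: "'n \<Rightarrow> 'm \<Rightarrow> real ^ 'd::finite"
    and S :: "('m, 'd) stack"
    and X :: "nat \<Rightarrow> ('m, 'd) stack"
    and \<beta> \<gamma> :: real
  assumes "graph_connected E"
    and "\<forall>i. affinely_nondegenerate E x i"
    and "S \<in> alignments" and "nondegenerate (C_mat E x) S"
    and "0 < \<beta>" "\<beta> < 1" "0 < \<gamma>" "\<gamma> < 1"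
    and "rgd_sequence (C_mat E x) \<beta> \<gamma> X"
    and "X \<longlonglongrightarrow> reduce S"
  shows "linear_convergence X (reduce S)"
proof -
  define C where "C = C_mat E x"
  define P where "P = reduce S"
  define f where "f = reduced_objective C"
  define G where "G Y = grad_objective C (prepend_id Y)" for Y
  define c where "c = real CARD('m) * norm (mat 1 :: real ^ 'd ^ 'd)"
  have C: "transpose C = C" by (simp add: C_def transpose_C_mat)
  have P: "P \<in> reduced_alignments" unfolding P_def by (rule reduce_in_reduced_alignments) fact
  have lim: "X \<longlonglongrightarrow> P" unfolding P_def by fact
  have X_Suc: "X (Suc k) = rgd_step C \<beta> \<gamma> (X k)" and X_0: "X 0 \<in> reduced_alignments" for k
    using assms(9) by (simp_all add: rgd_sequence_def C_def)
  \<comment> \<open>The summand 1 in the denominator keeps the threshold meaningful when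
    \<open>C\<close> is zero.\<close>
  obtain l where l: "\<beta> ^ l < (1 - \<gamma>) / (3 * norm C * c\<^sup>2 + 1)"
    using real_arch_pow_inv[of "(1 - \<gamma>) / (3 * norm C * c\<^sup>2 + 1)" \<beta>] assms(5-8)
    by (auto simp: add_nonneg_pos)
  have "0 < 3 * norm C * c\<^sup>2 + 1" by (simp add: add_nonneg_pos)
  then have "3 * norm C * c\<^sup>2 * \<beta> ^ l \<le> 1 - \<gamma>"
    using l assms(5) by (simp add: field_simps) (smt (verit) zero_less_power)
  note step = rgd_step_props[OF C _ assms(5-7) this[unfolded c_def], folded G_def c_def f_def]
  have X: "X k \<in> reduced_alignments" for k
    by (induction k) (simp_all add: X_0 X_Suc step(1))
  have decr: "\<gamma> * \<beta> ^ l * (norm (G (X k)))\<^sup>2 \<le> f (X k) - f (X (Suc k))"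
    and moved: "norm (X (Suc k) - X k) \<le> 2 * real CARD('m) * c * norm (G (X k))" for k
    using step(2,3)[OF X[of k]] by (simp_all add: X_Suc)
  define \<delta> where "\<delta> = \<gamma> * \<beta> ^ l"
  have "0 < \<delta>" using assms(5,7) by (simp add: \<delta>_def)
  have dec: "f (X (Suc k)) \<le> f (X k)" for k
    using decr[of k] \<open>0 < \<delta>\<close> unfolding \<delta>_def by (smt (verit) mult_nonneg_nonneg zero_le_power2)
  have "isCont f P"
    using GDERIV_reduced_objective[OF C, of P] has_derivative_continuous
    unfolding f_def gderiv_def by blast
  then have f_lim: "(\<lambda>k. f (X k)) \<longlonglongrightarrow> f P"
    using lim by (rule isCont_tendsto_compose)
  \<comment> \<open>The values decrease to \<open>f P\<close>; this gives the bound at every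
    iterate, including those outside the neighbourhood where \<open>P\<close> is known to be
    minimal.\<close>
  have f_ge: "f P \<le> f (X k)" for k
    using decseq_ge[OF decseq_SucI[of "\<lambda>k. f (X k)"] f_lim] dec by simp
  have "isCont G P"
    unfolding G_def
    using has_derivative_continuous[OF has_derivative_prepend_id]
      differentiable_imp_continuous_within[OF differentiable_grad_objective]
    by (rule isCont_o2)
  then have G_lim: "(\<lambda>k. G (X k)) \<longlonglongrightarrow> G P"
    using lim by (rule isCont_tendsto_compose)
  \<comment> \<open>Consecutive values share their limit, so passing to the limit in the decrease
    inequality forces the full gradient at \<open>P\<close>, first block included, to
    vanish.\<close>
  have "(\<lambda>k. (f (X k) - f (X (Suc k))) / \<delta>) \<longlonglongrightarrow> (f P - f P) / \<delta>"
    using \<open>0 < \<delta>\<close> by (intro tendsto_intros f_lim LIMSEQ_Suc[OF f_lim]) simp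
  moreover have "(norm (G (X k)))\<^sup>2 \<le> (f (X k) - f (X (Suc k))) / \<delta>" for k
    using decr[of k] \<open>0 < \<delta>\<close> by (simp add: \<delta>_def field_simps)
  moreover have "(\<lambda>k. (norm (G (X k)))\<^sup>2) \<longlonglongrightarrow> (norm (G P))\<^sup>2"
    by (intro tendsto_intros G_lim)
  ultimately have "(norm (G P))\<^sup>2 \<le> (f P - f P) / \<delta>"
    by (intro LIMSEQ_le) auto
  then have "G P = 0" by simp
  have grad: "reduced_grad f Y = drop_first (G Y)" for Y
    by (simp add: f_def G_def reduced_grad_reduced_objective[OF C])
  have crit: "reduced_grad f P = 0"
    by (simp add: grad \<open>G P = 0\<close> linear_0[OF bounded_linear.linear[OF bounded_linear_drop_first]])
  obtain K where K: "0 \<le> K" "\<And>Y. Y \<in> reduced_alignments \<Longrightarrow> f Y - f P \<le> K * (norm (Y - P))\<^sup>2"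
    using reduced_objective_quadratic_bound[OF C P] crit unfolding f_def by blast
  obtain \<mu> r where \<mu>: "0 < \<mu>" "0 < r" "\<And>Y. Y \<in> reduced_alignments \<Longrightarrow> norm (Y - P) < r \<Longrightarrow>
      \<mu> * norm (Y - P) \<le> norm (reduced_grad f Y)"
    using reduced_grad_lower_bound[OF P crit] differentiable_reduced_grad[OF C] assms(4)
    unfolding f_def nondegenerate_def C_def P_def by blast
  have dom: "f (X k) - f P \<le> K / \<mu>\<^sup>2 * (norm (G (X k)))\<^sup>2" if "norm (X k - P) < r" for k
  proof -
    \<comment> \<open>The error bound is about the reduced gradient, the decrease about the full
      one; deleting a block only shortens it.\<close>
    have "\<mu> * norm (X k - P) \<le> norm (G (X k))"
      using \<mu>(3)[OF X that] norm_drop_first_le[of "G (X k)"] by (simp add: grad)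
    then have "(\<mu> * norm (X k - P))\<^sup>2 \<le> (norm (G (X k)))\<^sup>2"
      using \<mu>(1) by (intro power_mono) simp_all
    then have "(norm (X k - P))\<^sup>2 \<le> (norm (G (X k)))\<^sup>2 / \<mu>\<^sup>2"
      using \<mu>(1) by (simp add: field_simps power_mult_distrib)
    then have "K * (norm (X k - P))\<^sup>2 \<le> K * ((norm (G (X k)))\<^sup>2 / \<mu>\<^sup>2)"
      using K(1) by (rule mult_left_mono)
    then show ?thesis using K(2)[OF X, of k] by simp
  qed
  have "\<forall>\<^sub>F k in sequentially. norm (X k - P) < r"
    using tendstoD[OF lim \<mu>(2)] by (simp add: dist_norm)
  then have ev_dom: "\<forall>\<^sub>F k in sequentially. f (X k) - f P \<le> K / \<mu>\<^sup>2 * (norm (G (X k)))\<^sup>2"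
    by (rule eventually_mono) (rule dom)
  have "linear_convergence X P"
  proof (rule linear_convergence_of_gradient_dominated[OF lim \<open>0 < \<delta>\<close> _ _ _ _ ev_dom])
    show "0 \<le> 2 * real CARD('m) * c" by (simp add: c_def)
    show "0 \<le> f (X k) - f P" for k using f_ge[of k] by simp
    show "\<delta> * (norm (G (X k)))\<^sup>2 \<le> f (X k) - f P - (f (X (Suc k)) - f P)" for k
      using decr[of k] by (simp add: \<delta>_def)
    show "norm (X (Suc k) - X k) \<le> 2 * real CARD('m) * c * norm (G (X k))" for k
      by (rule moved)
  qed
  then show ?thesis by (simp only: P_def)
qed

end
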